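(* Let $R_k$ denote either $R_k(t) := |P_k(e^{it})|^2$ for all $k$ or $R_k(t) := |Q_k(e^{it})|^2$ for all $k$, and let $n := 2^k$. For every real $\eta \in (-1/2, 1/2)$ and every $\varepsilon > 0$ there exists $k_{\eta,\varepsilon}$ such that for every integer $k \geq k_{\eta,\varepsilon}$ the equation $R_k(t) = (1+\eta)n$ has at least $(1/2 - |\eta| - \varepsilon)\, n/2$ distinct solutions $t \in K$.
   Context: The Rudin-Shapiro polynomials are defined recursively by $P_0(z) := 1$, $Q_0(z) := 1$, and for $k = 0,1,2,\ldots$: $P_{k+1}(z) := P_k(z) + z^{2^k} Q_k(z)$, $Q_{k+1}(z) := P_k(z) - z^{2^k} Q_k(z)$. Thus $P_k$ and $Q_k$ are polynomials of degree $n-1$, $n = 2^k$, with all coefficients in $\{-1,1\}$. $K := \mathbb{R} \pmod{2\pi}$, i.e. solutions are counted on one period $[0,2\pi)$. *)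

theory Defs
  imports "HOL-Analysis.Analysis" "HOL-Computational_Algebra.Polynomial"
begin

fun RS :: "nat \<Rightarrow> int poly \<times> int poly" where
  "RS 0 = (1, 1)"
| "RS (Suc k) = (let (p, q) = RS k in
     (p + monom 1 (2^k) * q, p - monom 1 (2^k) * q))"

definition RS_P :: "nat \<Rightarrow> int poly" where "RS_P k = fst (RS k)"
definition RS_Q :: "nat \<Rightarrow> int poly" where "RS_Q k = snd (RS k)"

definition sqmod_on_circle :: "int poly \<Rightarrow> real \<Rightarrow> real" where
  "sqmod_on_circle p t = (cmod (poly (map_poly of_int p) (cis t)))\<^sup>2"

end

theory Submission
  imports Defs
begin

text \<open>
  Write a_k = (|P_k|^2 - |Q_k|^2) / 2^(k+1) and b_k = 2 P_k cnj Q_k / 2^(k+1) on the unit circle;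
  then (a_k, b_k) is a point of the two-sphere, |P_k|^2 = (1 + a_k) 2^k and |Q_k|^2 = (1 - a_k) 2^k.
  With u = exp (i 2^k t), one step of the recursion is the rotation a' = Re (cnj u b),
  b' = a - i Im (cnj u b).

  Counting. At the points t_j = 2 pi j / 2^k two steps of the rotation give
  a_k(t_j) = (-1)^j a_{k-2}(t_j). So a_k crosses the levels \<eta> and -\<eta> on an interval between
  neighbouring points unless a_{k-2} crosses one of these levels there or stays between them. Being a
  trigonometric polynomial of degree less than 2^(k-2), a_{k-2} has at most 2^(k-1) crossings per
  level, and the symmetry a_k(t + pi) = - a_k(t) makes both levels of a_k equally frequent. It remains
  to bound the time that a_{k-2} spends in [-\<eta>, \<eta>].

  Equidistribution. That a_k becomes uniformly distributed on [-1, 1] (Rodgers' theorem, conjectured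
  by Saffari) is proved by moments. The coefficients of the l-th power of the quadratic form
  -b X^2 + 2 a X Y + cnj b Y^2 span the spin-l representation, with the Legendre polynomial of a_k in
  the middle, and their Fourier modes at the frequencies m 2^k, |m| < l, obey a finite linear
  recursion. It is a contraction that loses exactly the modes of the wrong parity, so those tend
  to 0. A downward induction on m then forces the limit of each mode to be a multiple of
  Y^(l-m) (X+Y)^(l+m), which has a nonzero coefficient of the wrong parity; so every mode tends to 0.
\<close>

section \<open>The Krawtchouk transform\<close>

text \<open>
  The matrix of the substitution (X, Y) to (X + Y, X - Y) on binary forms of degree d; it is
  \<open>2 ^ (d / 2)\<close> times an isometry for the weights \<open>1 / (d choose i)\<close>.
\<close>

definition kraw :: "nat \<Rightarrow> nat \<Rightarrow> nat \<Rightarrow> real" where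
  "kraw d i j = coeff ([:1, 1:] ^ (d - i) * [:1, -1:] ^ i) j"

lemma degree_kraw_poly:
  assumes "i \<le> d"
  shows "degree ([:1, 1:] ^ (d - i) * [:1, -1:] ^ i :: real poly) \<le> d"
proof -
  have "degree ([:1, 1:] ^ (d - i) * [:1, -1:] ^ i :: real poly) \<le> (d - i) + i"
    by (intro order.trans[OF degree_mult_le] add_mono order.trans[OF degree_power_le]) auto
  thus ?thesis using assms by simp
qed

lemma poly_altdef_le:
  fixes p :: "'a::comm_semiring_1 poly"
  assumes "degree p \<le> d"
  shows "poly p x = (\<Sum>i\<le>d. coeff p i * x ^ i)"
  unfolding poly_altdef
  by (rule sum.mono_neutral_left) (use assms in \<open>auto simp: coeff_eq_0\<close>)

lemma kraw_sum:
  assumes "i \<le> d"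
  shows "(\<Sum>j\<le>d. kraw d i j * y ^ j) = (1 + y) ^ (d - i) * (1 - y) ^ i"
proof -
  let ?p = "[:1, 1:] ^ (d - i) * [:1, -1:] ^ i :: real poly"
  have "poly ?p y = (\<Sum>j\<le>d. coeff ?p j * y ^ j)"
    by (rule poly_altdef_le[OF degree_kraw_poly[OF assms]])
  thus ?thesis by (simp add: kraw_def)
qed

lemma polyfun_coeffs_eq:
  fixes f g :: "nat \<Rightarrow> real"
  assumes "\<And>x. (\<Sum>i\<le>d. f i * x ^ i) = (\<Sum>i\<le>d. g i * x ^ i)" "i \<le> d"
  shows "f i = g i"
proof -
  have "\<forall>x. (\<Sum>i\<le>d. (f i - g i) * x ^ i) = 0"
    using assms(1) by (simp add: left_diff_distrib sum_subtractf)
  from this[unfolded polyfun_eq_0] assms(2) show ?thesis by auto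
qed

text \<open>The generating function of \<open>(d choose i) * kraw d i j\<close> is
  \<open>(1 + x + y - x * y) ^ d\<close>, which is symmetric in \<open>x\<close> and
  \<open>y\<close>.\<close>

lemma kraw_symmetric:
  assumes "i \<le> d" "j \<le> d"
  shows "real (d choose i) * kraw d i j = real (d choose j) * kraw d j i"
proof -
  define f where "f i j = real (d choose i) * kraw d i j" for i j
  have gen: "(\<Sum>j\<le>d. (\<Sum>i\<le>d. f i j * x ^ i) * y ^ j) = (1 + x + y - x * y) ^ d" for x y
  proof -
    have "(\<Sum>j\<le>d. (\<Sum>i\<le>d. f i j * x ^ i) * y ^ j) = (\<Sum>i\<le>d. \<Sum>j\<le>d. f i j * x ^ i * y ^ j)"
      by (subst sum.swap) (simp add: sum_distrib_right)
    also have "\<dots> = (\<Sum>i\<le>d. real (d choose i) * x ^ i * (\<Sum>j\<le>d. kraw d i j * y ^ j))"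
      by (simp add: f_def sum_distrib_left mult_ac)
    also have "\<dots> = (\<Sum>i\<le>d. real (d choose i) * (x * (1 - y)) ^ i * (1 + y) ^ (d - i))"
      by (intro sum.cong refl, subst kraw_sum) (auto simp: power_mult_distrib)
    also have "\<dots> = (x * (1 - y) + (1 + y)) ^ d"
      by (simp add: binomial_ring)
    finally show ?thesis by (simp add: algebra_simps)
  qed
  have "(\<Sum>i\<le>d. f i j * x ^ i) = (\<Sum>i\<le>d. f j i * x ^ i)" if "j \<le> d" for j x
  proof (rule polyfun_coeffs_eq[where i = j and d = d])
    fix y
    have "(\<Sum>j\<le>d. (\<Sum>i\<le>d. f j i * x ^ i) * y ^ j) = (\<Sum>i\<le>d. (\<Sum>j\<le>d. f j i * y ^ j) * x ^ i)"
      by (simp add: sum_distrib_right) (subst sum.swap, simp add: mult_ac)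
    thus "(\<Sum>j\<le>d. (\<Sum>i\<le>d. f i j * x ^ i) * y ^ j) = (\<Sum>j\<le>d. (\<Sum>i\<le>d. f j i * x ^ i) * y ^ j)"
      unfolding gen by (simp add: mult.commute add_ac)
  qed (use that in auto)
  from polyfun_coeffs_eq[OF this[OF assms(2)] assms(1)] show ?thesis
    by (simp add: f_def)
qed

lemma kraw_hom_sum:
  assumes "i \<le> d" "x \<noteq> 0"
  shows "(\<Sum>j\<le>d. kraw d i j * x ^ (d - j) * y ^ j) = (x + y) ^ (d - i) * (x - y) ^ i"
proof -
  have "(\<Sum>j\<le>d. kraw d i j * x ^ (d - j) * y ^ j) = x ^ d * (\<Sum>j\<le>d. kraw d i j * (y / x) ^ j)"
    using assms(2) by (auto simp: sum_distrib_left power_divide power_diff intro!: sum.cong)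
  also have "\<dots> = x ^ (d - i) * x ^ i * ((1 + y / x) ^ (d - i) * (1 - y / x) ^ i)"
    using assms(1) by (simp add: kraw_sum flip: power_add)
  also have "\<dots> = (x * (1 + y / x)) ^ (d - i) * (x * (1 - y / x)) ^ i"
    by (simp add: power_mult_distrib)
  also have "\<dots> = (x + y) ^ (d - i) * (x - y) ^ i"
    using assms(2) by (simp add: distrib_left right_diff_distrib)
  finally show ?thesis .
qed

text \<open>Applying the substitution twice doubles both variables, which multiplies a form of
  degree \<open>d\<close> by \<open>2 ^ d\<close>.\<close>

lemma kraw_involution:
  assumes "i \<le> d" "m \<le> d"
  shows "(\<Sum>j\<le>d. kraw d i j * kraw d j m) = (if i = m then 2 ^ d else 0)"
proof -
  let ?f = "\<lambda>m. \<Sum>j\<le>d. kraw d i j * kraw d j m"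
  let ?p = "\<Sum>m\<le>d. monom (?f m - (if i = m then 2 ^ d else 0)) m"
  \<comment> \<open>The sum over \<open>j\<close> is evaluated by \<open>kraw_hom_sum\<close> with
    first argument \<open>1 + y\<close>, which must be nonzero; the remaining points still force
    \<open>?p = 0\<close>.\<close>
  have *: "poly ?p y = 0" if "y \<noteq> -1" for y
  proof -
    have "(\<Sum>m\<le>d. ?f m * y ^ m) = (\<Sum>j\<le>d. kraw d i j * (\<Sum>m\<le>d. kraw d j m * y ^ m))"
      by (simp add: sum_distrib_right sum_distrib_left) (subst sum.swap, simp add: mult_ac)
    also have "\<dots> = (\<Sum>j\<le>d. kraw d i j * (1 + y) ^ (d - j) * (1 - y) ^ j)"
      by (intro sum.cong) (auto simp: kraw_sum)
    also have "\<dots> = 2 ^ (d - i) * (2 * y) ^ i"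
      using that assms by (subst kraw_hom_sum) (auto simp: algebra_simps)
    also have "\<dots> = 2 ^ d * y ^ i"
      using assms by (simp add: power_mult_distrib flip: power_add)
    also have "\<dots> = (\<Sum>m\<le>d. (if i = m then 2 ^ d else 0) * y ^ m)"
      using assms by (simp add: if_distrib[where f = "\<lambda>x. x * _"] cong: if_cong)
    finally show ?thesis
      by (simp add: poly_sum poly_monom left_diff_distrib sum_subtractf)
  qed
  have "?p = 0"
  proof (rule ccontr)
    assume "?p \<noteq> 0"
    hence "finite {y. poly ?p y = 0}" by (rule poly_roots_finite)
    moreover have "UNIV - {-1} \<subseteq> {y. poly ?p y = 0}" using * by auto
    ultimately have "finite (UNIV - {-1 :: real})" by (rule finite_subset[rotated])
    thus False by (simp add: infinite_UNIV_char_0)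
  qed
  hence "coeff ?p m = 0" by simp
  moreover have "coeff ?p m = (\<Sum>j\<le>d. if j = m then ?f m - (if i = m then 2 ^ d else 0) else 0)"
    unfolding coeff_sum coeff_monom by (rule sum.cong) auto
  ultimately show ?thesis using assms by simp
qed

text \<open>Symmetry moves the weight from \<open>j\<close> to \<open>i\<close>, so the Gram matrix
  becomes the square of \<open>kraw\<close>, which is \<open>2 ^ d\<close> times the
  identity.\<close>

lemma kraw_isometry:
  "(\<Sum>j\<le>d. (\<Sum>i\<le>d. kraw d i j * h i)\<^sup>2 / real (d choose j)) = 2 ^ d * (\<Sum>i\<le>d. (h i)\<^sup>2 / real (d choose i))"
proof -
  have w: "kraw d i j / real (d choose j) = kraw d j i / real (d choose i)" if "i \<le> d" "j \<le> d" for i j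
    using kraw_symmetric[OF that] that by (simp add: field_simps)
  have "(\<Sum>j\<le>d. (\<Sum>i\<le>d. kraw d i j * h i)\<^sup>2 / real (d choose j)) =
        (\<Sum>j\<le>d. \<Sum>i\<le>d. \<Sum>m\<le>d. h i * h m * (kraw d i j / real (d choose j)) * kraw d m j)"
    by (simp add: power2_eq_square sum_product sum_divide_distrib mult_ac)
  also have "\<dots> = (\<Sum>j\<le>d. \<Sum>i\<le>d. \<Sum>m\<le>d. h i * h m / real (d choose i) * (kraw d m j * kraw d j i))"
    by (intro sum.cong refl) (simp add: w)
  also have "\<dots> = (\<Sum>i\<le>d. \<Sum>m\<le>d. \<Sum>j\<le>d. h i * h m / real (d choose i) * (kraw d m j * kraw d j i))"
    by (subst sum.swap, rule sum.cong[OF refl], rule sum.swap)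
  also have "\<dots> = (\<Sum>i\<le>d. \<Sum>m\<le>d. h i * h m / real (d choose i) * (if m = i then 2 ^ d else 0))"
    by (intro sum.cong refl, subst sum_distrib_left[symmetric], subst kraw_involution) auto
  also have "\<dots> = (\<Sum>i\<le>d. \<Sum>m\<le>d. if m = i then 2 ^ d * ((h i)\<^sup>2 / real (d choose i)) else 0)"
    by (intro sum.cong refl) (auto simp: power2_eq_square)
  also have "\<dots> = 2 ^ d * (\<Sum>i\<le>d. (h i)\<^sup>2 / real (d choose i))"
    by (simp add: sum_distrib_left)
  finally show ?thesis .
qed

text \<open>Multiplication by \<open>[:1, 1:] ^ D\<close> is unitriangular, so the coefficients of
  \<open>r k\<close> below \<open>e\<close> are recovered one after the other. Nothing is assumed
  about coefficient \<open>e\<close> of the product. Instead, \<open>r k\<close> has no term of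
  degree \<open>Suc e\<close>, so coefficient \<open>Suc e\<close> of the product is
  \<open>D * coeff (r k) e\<close> plus lower terms.\<close>

lemma coeffs_tendsto_0_of_mult:
  fixes r :: "nat \<Rightarrow> real poly"
  assumes deg: "\<And>k. degree (r k) \<le> e" and "D \<ge> 1"
    and low: "\<And>j. j < e \<Longrightarrow> (\<lambda>k. coeff ([:1, 1:] ^ D * r k) j) \<longlonglongrightarrow> 0"
    and top: "(\<lambda>k. coeff ([:1, 1:] ^ D * r k) (Suc e)) \<longlonglongrightarrow> 0"
  shows "(\<lambda>k. coeff (r k) j) \<longlonglongrightarrow> 0"
proof -
  have cf: "coeff ([:1, 1:] ^ D * p) j = (\<Sum>i\<le>j. real (D choose i) * coeff p (j - i))" for p j
  proof -
    have "coeff ([:1, 1 :: real:] ^ D) i = real (D choose i)" for i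
      by (cases "i \<le> D") (auto simp: coeff_linear_poly_power coeff_eq_0 degree_linear_power binomial_eq_0)
    thus ?thesis by (simp add: coeff_mult)
  qed
  have lo: "(\<lambda>k. coeff (r k) j) \<longlonglongrightarrow> 0" if "j < e" for j
    using that
  proof (induction j rule: less_induct)
    case (less j)
    have "(\<lambda>k. coeff ([:1, 1:] ^ D * r k) j - (\<Sum>i\<in>{1..j}. real (D choose i) * coeff (r k) (j - i))) \<longlonglongrightarrow> 0 - (\<Sum>i\<in>{1..j}. real (D choose i) * 0)"
      using less by (intro tendsto_diff low tendsto_sum tendsto_mult tendsto_const) auto
    moreover have "coeff ([:1, 1:] ^ D * r k) j - (\<Sum>i\<in>{1..j}. real (D choose i) * coeff (r k) (j - i)) = coeff (r k) j" for k
      by (simp add: cf atMost_atLeast0 sum.atLeast_Suc_atMost)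
    ultimately show ?case by simp
  qed
  have "(\<lambda>k. coeff ([:1, 1:] ^ D * r k) (Suc e) - (\<Sum>i\<in>{2..Suc e}. real (D choose i) * coeff (r k) (Suc e - i))) \<longlonglongrightarrow> 0 - (\<Sum>i\<in>{2..Suc e}. real (D choose i) * 0)"
    by (intro tendsto_diff top tendsto_sum tendsto_mult tendsto_const lo) auto
  moreover have "coeff ([:1, 1:] ^ D * r k) (Suc e) - (\<Sum>i\<in>{2..Suc e}. real (D choose i) * coeff (r k) (Suc e - i)) = real D * coeff (r k) e" for k
  proof -
    have "coeff (r k) (Suc e) = 0" using deg[of k] by (intro coeff_eq_0) auto
    thus ?thesis by (simp add: cf atMost_atLeast0 sum.atLeast_Suc_atMost numeral_2_eq_2)
  qed
  ultimately have "(\<lambda>k. real D * coeff (r k) e) \<longlonglongrightarrow> 0" by simp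
  from tendsto_mult[OF tendsto_const[of "1 / real D"] this]
  have mid: "(\<lambda>k. coeff (r k) e) \<longlonglongrightarrow> 0" using \<open>D \<ge> 1\<close> by simp
  consider "j < e" | "j = e" | "j > e" by linarith
  thus ?thesis
  proof cases
    case 3
    hence "coeff (r k) j = 0" for k using deg[of k] by (intro coeff_eq_0) auto
    thus ?thesis by simp
  qed (use lo mid in auto)
qed

section \<open>Decay of the Fourier modes\<close>

text \<open>An energy argument. One step reads only modes of frequency \<open>2 * m + i - l\<close>,
  whose sum with \<open>i + l\<close> is even, and by \<open>kraw_isometry\<close> it does not
  increase their energy. So the odd part of the energy \<open>N\<close> is lost at every step; as
  \<open>N\<close> decreases to a limit, the losses tend to 0.\<close>

lemma odd_modes_tendsto_0:
  fixes c :: "nat \<Rightarrow> int \<Rightarrow> nat \<Rightarrow> real" and l :: nat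
  assumes rec: "\<And>k m j. j \<le> 2 * l \<Longrightarrow> c (Suc k) m j =
      (-1/2) ^ l * (\<Sum>i\<le>2*l. kraw (2 * l) i j * c k (2 * m + int i - int l) i)"
    and zero: "\<And>k m i. i \<le> 2 * l \<Longrightarrow> int l \<le> \<bar>m\<bar> \<Longrightarrow> c k m i = 0"
    and "i \<le> 2 * l" "odd (m + int i + int l)"
  shows "(\<lambda>k. c k m i) \<longlonglongrightarrow> 0"
proof -
  define d where "d = 2 * l"
  define w where "w i = real (d choose i)" for i
  define I where "I = {- int l..int l}"
  define N where "N k = (\<Sum>i\<le>d. \<Sum>m\<in>I. (c k m i)\<^sup>2 / w i)" for k
  have finI: "finite I" by (simp add: I_def)
  have wpos: "w i > 0" if "i \<le> d" for i using that by (simp add: w_def)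
  \<comment> \<open>The map from \<open>m\<close> to \<open>2 * m + i - l\<close> is injective and
    its values outside \<open>I\<close> carry no mode, so each even mode is read at most
    once.\<close>
  have half: "(\<Sum>m\<in>I. (c k (2 * m + int i - int l) i)\<^sup>2 / w i) \<le>
              (\<Sum>m\<in>{m\<in>I. even (m + int i + int l)}. (c k m i)\<^sup>2 / w i)" if i: "i \<le> d" for k i
  proof -
    define J where "J = (\<lambda>m. 2 * m + int i - int l) ` I"
    have "(\<Sum>m\<in>I. (c k (2 * m + int i - int l) i)\<^sup>2 / w i) = (\<Sum>m\<in>J. (c k m i)\<^sup>2 / w i)"
      unfolding J_def by (subst sum.reindex) (auto simp: inj_on_def)
    also have "\<dots> = (\<Sum>m\<in>J \<inter> I. (c k m i)\<^sup>2 / w i)"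
    proof (rule sum.mono_neutral_right)
      show "\<forall>m\<in>J - J \<inter> I. (c k m i)\<^sup>2 / w i = 0"
      proof
        fix m assume "m \<in> J - J \<inter> I"
        hence "int l \<le> \<bar>m\<bar>" by (auto simp: I_def)
        thus "(c k m i)\<^sup>2 / w i = 0" using zero[of i m k] i by (simp add: d_def)
      qed
    qed (auto simp: J_def I_def)
    also have "\<dots> \<le> (\<Sum>m\<in>{m\<in>I. even (m + int i + int l)}. (c k m i)\<^sup>2 / w i)"
      using wpos[OF i] by (intro sum_mono2 finite_subset[OF _ finI]) (auto simp: J_def)
    finally show ?thesis .
  qed
  have step: "N (Suc k) \<le> (\<Sum>i\<le>d. \<Sum>m\<in>{m\<in>I. even (m + int i + int l)}. (c k m i)\<^sup>2 / w i)" for k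
  proof -
    have "N (Suc k) = (\<Sum>m\<in>I. \<Sum>j\<le>d. (c (Suc k) m j)\<^sup>2 / w j)"
      unfolding N_def by (rule sum.swap)
    also have "\<dots> = (\<Sum>m\<in>I. \<Sum>i\<le>d. (c k (2 * m + int i - int l) i)\<^sup>2 / w i)"
    proof (rule sum.cong[OF refl])
      fix m
      have "(\<Sum>j\<le>d. (c (Suc k) m j)\<^sup>2 / w j) = (\<Sum>j\<le>d. ((-1/2) ^ l)\<^sup>2 *
              ((\<Sum>i\<le>d. kraw d i j * c k (2 * m + int i - int l) i)\<^sup>2 / w j))"
        by (intro sum.cong refl, subst rec) (auto simp: d_def power_mult_distrib)
      also have "\<dots> = ((-1/2) ^ l)\<^sup>2 * (2 ^ d * (\<Sum>i\<le>d. (c k (2 * m + int i - int l) i)\<^sup>2 / w i))"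
        unfolding w_def kraw_isometry[symmetric] by (simp add: sum_distrib_left)
      also have "((-1/2 :: real) ^ l)\<^sup>2 = 1 / 2 ^ d"
      proof -
        have "((-1/2 :: real) ^ l)\<^sup>2 = ((-1/2)\<^sup>2) ^ l" by (simp only: power_mult[symmetric] mult.commute)
        also have "\<dots> = 1 / 2 ^ d" by (simp add: d_def power_mult power2_eq_square power_one_over)
        finally show ?thesis .
      qed
      finally show "(\<Sum>j\<le>d. (c (Suc k) m j)\<^sup>2 / w j) = (\<Sum>i\<le>d. (c k (2 * m + int i - int l) i)\<^sup>2 / w i)"
        by simp
    qed
    also have "\<dots> = (\<Sum>i\<le>d. \<Sum>m\<in>I. (c k (2 * m + int i - int l) i)\<^sup>2 / w i)"
      by (rule sum.swap)
    also have "\<dots> \<le> (\<Sum>i\<le>d. \<Sum>m\<in>{m\<in>I. even (m + int i + int l)}. (c k m i)\<^sup>2 / w i)"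
      by (intro sum_mono half) auto
    finally show ?thesis .
  qed
  have Nsplit: "N k = (\<Sum>i\<le>d. \<Sum>m\<in>{m\<in>I. even (m + int i + int l)}. (c k m i)\<^sup>2 / w i) +
                      (\<Sum>i\<le>d. \<Sum>m\<in>{m\<in>I. odd (m + int i + int l)}. (c k m i)\<^sup>2 / w i)" for k
    unfolding N_def sum.distrib[symmetric]
  proof (rule sum.cong[OF refl])
    fix i
    have I: "I = {m\<in>I. even (m + int i + int l)} \<union> {m\<in>I. odd (m + int i + int l)}" by auto
    show "(\<Sum>m\<in>I. (c k m i)\<^sup>2 / w i) = (\<Sum>m\<in>{m\<in>I. even (m + int i + int l)}. (c k m i)\<^sup>2 / w i) +
              (\<Sum>m\<in>{m\<in>I. odd (m + int i + int l)}. (c k m i)\<^sup>2 / w i)"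
      by (subst I, rule sum.union_disjoint) (auto intro: finite_subset[of _ I] simp: finI)
  qed
  show ?thesis
  proof (cases "m \<in> I")
    case False
    hence "c k m i = 0" for k using assms(3) by (intro zero) (auto simp: I_def)
    thus ?thesis by simp
  next
    case True
    have i: "i \<le> d" using assms(3) by (simp add: d_def)
    have nonneg: "0 \<le> (c k m i)\<^sup>2 / w i" if "i \<le> d" for k m i
      using wpos[OF that] by simp
    have loss: "(c k m i)\<^sup>2 / w i \<le> N k - N (Suc k)" for k
    proof -
      have "(c k m i)\<^sup>2 / w i \<le> (\<Sum>m\<in>{m\<in>I. odd (m + int i + int l)}. (c k m i)\<^sup>2 / w i)"
        using True assms(4) i nonneg by (intro member_le_sum finite_subset[OF _ finI]) auto
      also have "\<dots> \<le> (\<Sum>i\<le>d. \<Sum>m\<in>{m\<in>I. odd (m + int i + int l)}. (c k m i)\<^sup>2 / w i)"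
        using i nonneg by (intro member_le_sum sum_nonneg) auto
      finally show ?thesis using step[of k] Nsplit[of k] by linarith
    qed
    have "decseq N"
    proof (rule decseq_SucI)
      fix k show "N (Suc k) \<le> N k"
        using loss[of k] nonneg[OF i, of k m] by linarith
    qed
    moreover have "0 \<le> N k" for k
      unfolding N_def by (intro sum_nonneg nonneg) auto
    ultimately obtain L where "N \<longlonglongrightarrow> L"
      using decseq_convergent by blast
    hence "(\<lambda>k. N k - N (Suc k)) \<longlonglongrightarrow> L - L"
      by (intro tendsto_diff) (auto simp: LIMSEQ_Suc)
    hence "(\<lambda>k. (c k m i)\<^sup>2 / w i) \<longlonglongrightarrow> 0"
      using tendsto_sandwich[of "\<lambda>_. 0" "\<lambda>k. (c k m i)\<^sup>2 / w i" sequentially "\<lambda>k. N k - N (Suc k)" 0] loss nonneg[OF i]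
      by (auto intro: always_eventually)
    from tendsto_mult[OF this tendsto_const[of "w i"]]
    have "(\<lambda>k. (c k m i)\<^sup>2) \<longlonglongrightarrow> 0" using wpos[OF i] by simp
    from tendsto_real_sqrt[OF this] show ?thesis
      by (simp add: tendsto_rabs_zero_iff)
  qed
qed

text \<open>
  In the induction step for frequency M, the modes of frequency M are asymptotically the
  coefficients of a polynomial \<open>[:1, 1:] ^ (l + M) * r\<close> with \<open>degree r \<le> l - M\<close>. The induction
  hypothesis kills the coefficients below \<open>l - M\<close>, and parity kills the one at \<open>l - M + 1\<close>,
  which determines \<open>r\<close>.
\<close>

lemma all_modes_tendsto_0:
  fixes c :: "nat \<Rightarrow> int \<Rightarrow> nat \<Rightarrow> real" and l :: nat
  assumes rec: "\<And>k m j. j \<le> 2 * l \<Longrightarrow> c (Suc k) m j =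
      (-1/2) ^ l * (\<Sum>i\<le>2*l. kraw (2 * l) i j * c k (2 * m + int i - int l) i)"
    and zero: "\<And>k m i. i \<le> 2 * l \<Longrightarrow> int l \<le> \<bar>m\<bar> \<Longrightarrow> c k m i = 0"
    and "i \<le> 2 * l"
  shows "(\<lambda>k. c k m i) \<longlonglongrightarrow> 0"
  using assms(3)
proof (induction "nat (int l - m)" arbitrary: m i rule: less_induct)
  case (less M)
  note odd = odd_modes_tendsto_0[of l c, OF rec zero]
  have IH: "(\<lambda>k. c k m i) \<longlonglongrightarrow> 0" if "m > M" "i \<le> 2 * l" for m i
  proof (cases "m < int l")
    case True
    thus ?thesis using that by (intro less.hyps) auto
  qed (use that zero[of i m] in auto)
  show ?case
  proof (cases "int l \<le> \<bar>M\<bar>")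
    case True
    thus ?thesis using zero less.prems by simp
  next
    case False
    define d where "d = 2 * l"
    define e where "e = nat (int l - M)"
    have e: "int e = int l - M" "1 \<le> e" "e < d" using False by (auto simp: e_def d_def)
    \<comment> \<open>By \<open>kraw_involution\<close> the recursion can be inverted: a mode of
      frequency \<open>2 * m + i - l\<close> is a combination of modes of the single frequency
      \<open>m\<close> one step later, which tend to 0 when \<open>m > M\<close>.\<close>
    have inv: "(\<lambda>k. c k (2 * m + int i - int l) i) \<longlonglongrightarrow> 0" if "m > M" "i \<le> d" for m i
    proof -
      have "(\<Sum>j\<le>d. kraw d j i * c (Suc k) m j) = (-1/2) ^ l * (2 ^ d * c k (2 * m + int i - int l) i)" for k
      proof -
        have "(\<Sum>j\<le>d. kraw d j i * c (Suc k) m j) =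
              (-1/2) ^ l * (\<Sum>j\<le>d. \<Sum>i'\<le>d. c k (2 * m + int i' - int l) i' * (kraw d i' j * kraw d j i))"
          by (simp add: rec d_def sum_distrib_left mult_ac)
        also have "\<dots> = (-1/2) ^ l * (\<Sum>i'\<le>d. c k (2 * m + int i' - int l) i' * (\<Sum>j\<le>d. kraw d i' j * kraw d j i))"
          by (subst sum.swap) (simp add: sum_distrib_left)
        also have "\<dots> = (-1/2) ^ l * (\<Sum>i'\<le>d. c k (2 * m + int i' - int l) i' * (if i' = i then 2 ^ d else 0))"
          using that by (simp add: kraw_involution)
        finally show ?thesis using that by (simp add: if_distrib[where f = "\<lambda>x. _ * x"] cong: if_cong)
      qed
      moreover have "(\<lambda>k. \<Sum>j\<le>d. kraw d j i * c (Suc k) m j) \<longlonglongrightarrow> (\<Sum>j\<le>d. kraw d j i * 0)"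
        using that by (intro tendsto_sum tendsto_mult tendsto_const LIMSEQ_Suc IH) (auto simp: d_def)
      ultimately have "(\<lambda>k. ((-1/2) ^ l * 2 ^ d) * c k (2 * m + int i - int l) i) \<longlonglongrightarrow> 0"
        by (simp add: mult_ac)
      from tendsto_mult[OF tendsto_const[of "1 / ((-1/2) ^ l * 2 ^ d)"] this] show ?thesis by simp
    qed
    \<comment> \<open>In the even case \<open>M = 2 * m + j - l\<close> with
      \<open>m = (M + l - j) / 2\<close>, and \<open>j < l - M\<close> says exactly that
      \<open>m > M\<close>.\<close>
    have low: "(\<lambda>k. c k M j) \<longlonglongrightarrow> 0" if "j < e" for j
    proof (cases "even (M + int j + int l)")
      case True
      hence "even (M + int l - int j)" by presburger
      then obtain m where m: "M + int l - int j = 2 * m" by (rule evenE)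
      have "m > M" using m that e by linarith
      moreover have "2 * m + int j - int l = M" using m by simp
      ultimately show ?thesis using inv[of m j] that e by simp
    next
      case False
      show ?thesis using that e False by (intro odd) (auto simp: d_def)
    qed
    \<comment> \<open>At \<open>Suc e\<close> the parity sum is
      \<open>M + (l - M + 1) + l = 2 * l + 1\<close>, which is odd.\<close>
    have high: "(\<lambda>k. c k M (Suc e)) \<longlonglongrightarrow> 0"
      using e by (intro odd) (auto simp: d_def)
    define h where "h k i = (-1/2) ^ l * c k (2 * M + int i - int l) i" for k i
    \<comment> \<open>For \<open>i > e\<close> the frequency \<open>2 * M + i - l\<close> exceeds
      \<open>M\<close>. The terms that survive have \<open>i \<le> e\<close> and share the factor
      \<open>[:1, 1:] ^ (d - e)\<close>, where \<open>d - e = l + M\<close> is positive.\<close>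
    have h0: "(\<lambda>k. h k i) \<longlonglongrightarrow> 0" if "e < i" "i \<le> d" for i
      unfolding h_def using that e by (intro tendsto_mult_right_zero IH) (auto simp: d_def)
    define r where "r k = (\<Sum>i\<le>e. smult (h k i) ([:1, 1:] ^ (e - i) * [:1, -1:] ^ i))" for k
    have degr: "degree (r k) \<le> e" for k
      unfolding r_def using degree_kraw_poly[of _ e]
      by (intro degree_sum_le order.trans[OF degree_smult_le]) auto
    define R where "R k j = coeff ([:1, 1:] ^ (d - e) * r k) j" for k j
    have R: "R k j = (\<Sum>i\<le>e. h k i * kraw d i j)" for k j
    proof -
      have "[:1, 1:] ^ (d - e) * r k = (\<Sum>i\<le>e. smult (h k i) ([:1, 1:] ^ (d - i) * [:1, -1:] ^ i))"
        unfolding r_def sum_distrib_left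
        using e by (intro sum.cong refl) (auto simp flip: power_add mult.assoc)
      thus ?thesis by (simp add: R_def coeff_sum kraw_def)
    qed
    have cR: "(\<lambda>k. c (Suc k) M j - R k j) \<longlonglongrightarrow> 0" if "j \<le> d" for j
    proof -
      have "(\<lambda>k. \<Sum>i\<in>{e<..d}. h k i * kraw d i j) \<longlonglongrightarrow> (\<Sum>i\<in>{e<..d}. 0 * kraw d i j)"
        by (intro tendsto_sum tendsto_mult tendsto_const h0) auto
      moreover have "c (Suc k) M j - R k j = (\<Sum>i\<in>{e<..d}. h k i * kraw d i j)" for k
      proof -
        have "{..d} = {..e} \<union> {e<..d}" using e by auto
        hence "(\<Sum>i\<le>d. h k i * kraw d i j) = R k j + (\<Sum>i\<in>{e<..d}. h k i * kraw d i j)"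
          unfolding R by (simp only:) (rule sum.union_disjoint, auto)
        moreover have "(\<Sum>i\<le>d. h k i * kraw d i j) = c (Suc k) M j"
          using that by (simp add: rec h_def d_def sum_distrib_left mult_ac)
        ultimately show ?thesis by simp
      qed
      ultimately show ?thesis by simp
    qed
    have R0: "(\<lambda>k. R k j) \<longlonglongrightarrow> 0" if "j \<le> d" "(\<lambda>k. c k M j) \<longlonglongrightarrow> 0" for j
      using tendsto_diff[OF LIMSEQ_Suc[OF that(2)] cR[OF that(1)]] by simp
    have "(\<lambda>k. coeff (r k) j) \<longlonglongrightarrow> 0" for j
    proof (rule coeffs_tendsto_0_of_mult[where e = e and D = "d - e"])
      show "(\<lambda>k. coeff ([:1, 1:] ^ (d - e) * r k) j) \<longlonglongrightarrow> 0" if "j < e" for j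
        using R0[OF _ low[OF that]] that e by (simp add: R_def)
      show "(\<lambda>k. coeff ([:1, 1:] ^ (d - e) * r k) (Suc e)) \<longlonglongrightarrow> 0"
        using R0[OF _ high] e by (simp add: R_def)
    qed (use e degr in auto)
    hence "(\<lambda>k. \<Sum>i'\<le>i. coeff ([:1, 1:] ^ (d - e)) i' * coeff (r k) (i - i')) \<longlonglongrightarrow>
             (\<Sum>i'\<le>i. coeff ([:1, 1:] ^ (d - e)) i' * 0)"
      by (intro tendsto_sum tendsto_mult tendsto_const)
    hence "(\<lambda>k. R k i) \<longlonglongrightarrow> 0"
      by (simp add: R_def coeff_mult)
    from tendsto_add[OF cR[of i] this] less.prems have "(\<lambda>k. c (Suc k) M i) \<longlonglongrightarrow> 0"
      by (simp add: d_def)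
    thus ?thesis by (rule LIMSEQ_imp_Suc)
  qed
qed

section \<open>Rudin-Shapiro polynomials on the circle\<close>

definition rs_p :: "nat \<Rightarrow> real \<Rightarrow> complex" where
  "rs_p k t = poly (map_poly of_int (RS_P k)) (cis t)"

definition rs_q :: "nat \<Rightarrow> real \<Rightarrow> complex" where
  "rs_q k t = poly (map_poly of_int (RS_Q k)) (cis t)"

lemma RS_P_Suc: "RS_P (Suc k) = RS_P k + monom 1 (2 ^ k) * RS_Q k"
  and RS_Q_Suc: "RS_Q (Suc k) = RS_P k - monom 1 (2 ^ k) * RS_Q k"
  by (simp_all add: RS_P_def RS_Q_def split: prod.splits)

lemma map_poly_of_int_add: "map_poly of_int (p + q) = map_poly of_int p + map_poly of_int q"
  and map_poly_of_int_diff: "map_poly of_int (p - q) = map_poly of_int p - map_poly of_int q"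
  and map_poly_of_int_monom_mult:
    "map_poly of_int (monom 1 n * q) = (monom 1 n * map_poly of_int q :: 'a::comm_ring_1 poly)"
  by (auto intro!: poly_eqI simp: coeff_map_poly coeff_monom_mult)

lemma rs_p_0 [simp]: "rs_p 0 t = 1" and rs_q_0 [simp]: "rs_q 0 t = 1"
  by (simp_all add: rs_p_def rs_q_def RS_P_def RS_Q_def)

lemma rs_p_Suc: "rs_p (Suc k) t = rs_p k t + cis (2 ^ k * t) * rs_q k t"
  and rs_q_Suc: "rs_q (Suc k) t = rs_p k t - cis (2 ^ k * t) * rs_q k t"
  by (simp_all add: rs_p_def rs_q_def RS_P_Suc RS_Q_Suc map_poly_of_int_add map_poly_of_int_diff
        map_poly_of_int_monom_mult poly_monom Complex.DeMoivre)

definition rs_a :: "nat \<Rightarrow> real \<Rightarrow> real" where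
  "rs_a k t = ((cmod (rs_p k t))\<^sup>2 - (cmod (rs_q k t))\<^sup>2) / 2 ^ Suc k"

definition rs_b :: "nat \<Rightarrow> real \<Rightarrow> complex" where
  "rs_b k t = 2 * rs_p k t * cnj (rs_q k t) / 2 ^ Suc k"

lemma rs_norm_sum: "(cmod (rs_p k t))\<^sup>2 + (cmod (rs_q k t))\<^sup>2 = 2 ^ Suc k"
proof (induction k)
  case (Suc k)
  have "(cmod (x + y))\<^sup>2 + (cmod (x - y))\<^sup>2 = 2 * ((cmod x)\<^sup>2 + (cmod y)\<^sup>2)" for x y
    unfolding cmod_power2 by (simp add: algebra_simps power2_eq_square)
  thus ?case using Suc by (simp add: rs_p_Suc rs_q_Suc norm_mult)
qed simp

lemma cmod_rs_p: "(cmod (rs_p k t))\<^sup>2 = (1 + rs_a k t) * 2 ^ k"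
  and cmod_rs_q: "(cmod (rs_q k t))\<^sup>2 = (1 - rs_a k t) * 2 ^ k"
  using arg_cong[OF rs_norm_sum[of k t], of "\<lambda>x. x * 2 ^ k"] by (simp_all add: rs_a_def field_simps)

lemma abs_rs_a_le: "\<bar>rs_a k t\<bar> \<le> 1"
proof -
  have "0 \<le> (1 + rs_a k t) * 2 ^ k" "0 \<le> (1 - rs_a k t) * 2 ^ k"
    unfolding cmod_rs_p[symmetric] cmod_rs_q[symmetric] by simp_all
  hence "0 \<le> (1 + rs_a k t) * 2 ^ k / 2 ^ k" "0 \<le> (1 - rs_a k t) * 2 ^ k / 2 ^ k"
    by (intro divide_nonneg_pos; simp)+
  thus ?thesis by simp
qed

lemma rs_a_0 [simp]: "rs_a 0 t = 0" and rs_b_0 [simp]: "rs_b 0 t = 1"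
  by (simp_all add: rs_a_def rs_b_def)

section \<open>One recursion step as a rotation of the sphere\<close>

lemma rs_a_Suc: "rs_a (Suc k) t = Re (cis (- (2 ^ k * t)) * rs_b k t)"
proof -
  define u where "u = cis (2 ^ k * t)"
  have *: "(cmod (x + y))\<^sup>2 - (cmod (x - y))\<^sup>2 = 4 * Re (x * cnj y)" for x y
    unfolding cmod_power2 by (simp add: algebra_simps power2_eq_square)
  have "cis (- (2 ^ k * t)) = cnj u" by (simp add: u_def cis_cnj)
  moreover have "cnj u * rs_b k t = (rs_p k t * cnj (u * rs_q k t)) / of_real (2 ^ k)"
    by (simp add: rs_b_def)
  moreover define X where "X = rs_p k t * cnj (u * rs_q k t)"
  ultimately show ?thesis
    unfolding rs_a_def rs_p_Suc rs_q_Suc u_def[symmetric] * X_def[symmetric]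
    by (simp only: Re_divide_of_real) simp
qed

lemma rs_b_Suc: "rs_b (Suc k) t = of_real (rs_a k t) - \<i> * of_real (Im (cis (- (2 ^ k * t)) * rs_b k t))"
proof -
  define u where "u = cis (2 ^ k * t)"
  have u1: "cmod u = 1" by (simp add: u_def)
  have *: "(x + y) * cnj (x - y) = of_real ((cmod x)\<^sup>2 - (cmod y)\<^sup>2) - 2 * \<i> * of_real (Im (x * cnj y))" for x y
    unfolding complex_eq_iff cmod_power2 by (simp add: algebra_simps power2_eq_square)
  have "cis (- (2 ^ k * t)) = cnj u" by (simp add: u_def cis_cnj)
  moreover have "cnj u * rs_b k t = (rs_p k t * cnj (u * rs_q k t)) / of_real (2 ^ k)"
    by (simp add: rs_b_def)
  moreover have "rs_b (Suc k) t = (rs_p k t + u * rs_q k t) * cnj (rs_p k t - u * rs_q k t) / 2 ^ Suc k"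
    unfolding rs_b_def rs_p_Suc rs_q_Suc u_def by (subst mult.assoc, subst power_Suc) simp
  ultimately show ?thesis
    unfolding * rs_a_def by (simp only: Im_divide_of_real norm_mult u1) (simp add: diff_divide_distrib)
qed

section \<open>Regularity, symmetries and level sets of \<open>rs_a\<close>\<close>

lemma continuous_rs [continuous_intros]:
  "continuous_on S (rs_p k)" "continuous_on S (rs_q k)"
  unfolding rs_p_def rs_q_def by (intro continuous_intros)+

lemma continuous_rs_a: "continuous_on S (rs_a k)"
  unfolding rs_a_def by (intro continuous_intros) simp

lemma rs_a_2pi: "rs_a k (t + 2 * pi) = rs_a k t"
  by (simp add: rs_a_def rs_p_def rs_q_def cis.ctr)

text \<open>The first step produces the pair \<open>cos t\<close>, \<open>\<i> * sin t\<close>,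
  which changes sign under the shift. From then on the rotation angle moves by a multiple of
  \<open>2 * pi\<close>, and the rotation is linear. At \<open>k = 0\<close> the pair is the
  constant 0, 1.\<close>

lemma rs_add_pi:
  assumes "k \<ge> 1"
  shows "rs_a k (t + pi) = - rs_a k t \<and> rs_b k (t + pi) = - rs_b k t"
  using assms
proof (induction k rule: dec_induct)
  case base
  show ?case by (simp add: rs_a_Suc rs_b_Suc complex_eq_iff)
next
  case (step k)
  have "cis (- (2 ^ k * (t + pi))) = cis (- (2 ^ k * t))"
  proof -
    obtain k' where k: "k = Suc k'" using step.hyps by (cases k) auto
    have "cis (- (2 ^ k * (t + pi))) = cis (- (2 ^ k * t)) * cis (2 * pi * real_of_int (- (2 ^ k')))"
      by (simp add: k cis_mult algebra_simps)
    thus ?thesis using cis_multiple_2pi[of "real_of_int (- (2 ^ k'))"] by (simp del: of_int_minus)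
  qed
  thus ?case using step.IH by (simp only: rs_a_Suc rs_b_Suc) (simp add: complex_eq_iff)
qed

lemma rs_a_add_pi: "k \<ge> 1 \<Longrightarrow> rs_a k (t + pi) = - rs_a k t"
  using rs_add_pi by blast

text \<open>At these points \<open>2 ^ Suc k * t\<close> is \<open>j * pi\<close>, so the last
  rotation contributes only a sign, and the real part of \<open>rs_b (Suc k)\<close> is
  \<open>rs_a k\<close>.\<close>

lemma rs_a_sample:
  "rs_a (Suc (Suc k)) (2 * pi * real j / 2 ^ Suc (Suc k)) =
     (-1) ^ j * rs_a k (2 * pi * real j / 2 ^ Suc (Suc k))"
proof -
  define t where "t = 2 * pi * real j / 2 ^ Suc (Suc k)"
  have "2 ^ Suc k * t = real j * pi" by (simp add: t_def)
  hence "cis (- (2 ^ Suc k * t)) = of_real ((-1) ^ j)"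
    by (simp only: complex_eq_iff cis.simps) (simp add: cos_npi sin_npi flip: of_real_power)
  thus ?thesis
    unfolding t_def[symmetric] rs_a_Suc[of "Suc k"] rs_b_Suc by (simp del: of_real_power)
qed

text \<open>On the circle \<open>reflect_poly p\<close> is \<open>z ^ N\<close> times the conjugate
  of \<open>p\<close>, so the level equation says that the polynomial \<open>A\<close> of degree at
  most \<open>2 * N\<close> vanishes, and \<open>cis\<close> is injective on a period. The function
  \<open>rs_a 0\<close> is constant, hence \<open>k \<ge> 1\<close>.\<close>

lemma rs_a_level_card:
  assumes "k \<ge> 1"
  shows "finite {t. 0 \<le> t \<and> t < 2 * pi \<and> rs_a k t = c}"
    and "card {t. 0 \<le> t \<and> t < 2 * pi \<and> rs_a k t = c} \<le> 2 * (2 ^ k - 1)"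
proof -
  let ?Z = "{t. 0 \<le> t \<and> t < 2 * pi \<and> rs_a k t = c}"
  define p :: "complex poly" where "p = map_poly of_int (RS_P k)"
  have "degree (RS_P k) \<le> 2 ^ k - 1 \<and> degree (RS_Q k) \<le> 2 ^ k - 1"
  proof (induction k)
    case (Suc k)
    have "degree (monom 1 (2 ^ k) * RS_Q k) \<le> 2 ^ k + (2 ^ k - 1)"
      using Suc by (intro order.trans[OF degree_mult_le] add_mono order.trans[OF degree_monom_le]) auto
    also have "\<dots> = 2 ^ Suc k - 1" by simp
    finally have m: "degree (monom 1 (2 ^ k) * RS_Q k) \<le> 2 ^ Suc k - 1" .
    have p: "degree (RS_P k) \<le> 2 ^ Suc k - 1" using Suc by (auto intro: order.trans)
    from m p show ?case unfolding RS_P_Suc RS_Q_Suc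
      by (auto intro: degree_add_le degree_diff_le)
  qed (auto simp: RS_P_def RS_Q_def)
  hence deg: "degree p \<le> 2 ^ k - 1"
    using map_poly_degree_leq[of "of_int :: int \<Rightarrow> complex" "RS_P k"] by (simp add: p_def)
  \<comment> \<open>The constant coefficient makes \<open>coeff A 0\<close> the leading coefficient
    of \<open>p\<close>; the linear one gives \<open>N \<ge> 1\<close>, so that the subtracted
    monomial leaves \<open>coeff A 0\<close> alone. Hence \<open>A\<close> is nonzero.\<close>
  have c01: "coeff (RS_P k) 0 = 1 \<and> coeff (RS_P k) 1 = 1"
    using assms
  proof (induction k rule: dec_induct)
    case base
    show ?case by (simp add: RS_P_Suc) (simp add: RS_P_def RS_Q_def)
  next
    case (step k)
    hence "(2::nat) ^ k \<ge> 2 ^ 1" by (intro power_increasing) auto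
    thus ?case using step by (simp add: RS_P_Suc coeff_monom_mult)
  qed
  define N where "N = degree p"
  have N: "N \<ge> 1" unfolding N_def by (rule le_degree) (simp add: p_def coeff_map_poly c01[unfolded One_nat_def])
  define A where "A = p * reflect_poly p - monom (of_real ((1 + c) * 2 ^ k)) N"
  have "coeff A 0 = lead_coeff p"
    using N c01 by (simp add: A_def coeff_mult p_def coeff_map_poly)
  moreover have "p \<noteq> 0" using N by (auto simp: N_def)
  ultimately have A0: "A \<noteq> 0" by auto
  have degA: "degree A \<le> 2 * N"
    unfolding A_def using degree_reflect_poly_le[of p]
    by (intro degree_diff_le order.trans[OF degree_mult_le] order.trans[OF degree_monom_le]) (auto simp: N_def)
  have root: "poly A (cis t) = 0" if "rs_a k t = c" for t
  proof -
    have "poly (reflect_poly p) (cis t) = cis t ^ N * poly p (inverse (cis t))"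
      by (simp add: poly_reflect_poly_nz N_def)
    also have "poly p (inverse (cis t)) = cnj (poly p (cis t))"
      by (subst poly_cnj_real) (auto simp: p_def coeff_map_poly cis_cnj)
    finally have "poly (p * reflect_poly p) (cis t) = cis t ^ N * (poly p (cis t) * cnj (poly p (cis t)))"
      by simp
    also have "poly p (cis t) * cnj (poly p (cis t)) = of_real ((1 + c) * 2 ^ k)"
      using cmod_rs_p[of k t] that by (simp only: complex_norm_square[symmetric] rs_p_def p_def of_real_power)
    finally show ?thesis by (simp add: A_def poly_monom)
  qed
  have inj: "inj_on cis ?Z" 
  proof (rule inj_onI)
    fix s t assume st: "s \<in> ?Z" "t \<in> ?Z" "cis s = cis t"
    from st(3) have "sin s = sin t \<and> cos s = cos t" by (simp add: complex_eq_iff)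
    then obtain n :: int where n: "s = t + 2 * pi * of_int n"
      unfolding sin_cos_eq_iff by blast
    have "\<bar>s - t\<bar> < 2 * pi" using st(1,2) by (simp add: abs_less_iff)
    hence "2 * pi * \<bar>of_int n\<bar> < 2 * pi * 1" by (simp add: n abs_mult)
    hence "\<bar>real_of_int n\<bar> < 1" by (rule mult_left_less_imp_less) simp
    hence "n = 0" by linarith
    thus "s = t" using n by simp
  qed
  have sub: "cis ` ?Z \<subseteq> {z. poly A z = 0}" using root by auto
  have fin: "finite {z. poly A z = 0}" using A0 by (rule poly_roots_finite)
  show "finite ?Z"
    using finite_subset[OF sub fin] inj by (rule finite_imageD)
  have "card ?Z = card (cis ` ?Z)" using inj by (simp add: card_image)
  also have "\<dots> \<le> card {z. poly A z = 0}" by (rule card_mono[OF fin sub])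
  also have "\<dots> \<le> degree A" using A0 by (rule card_poly_roots_bound)
  also have "\<dots> \<le> 2 * (2 ^ k - 1)" using degA deg by (simp add: N_def)
  finally show "card ?Z \<le> 2 * (2 ^ k - 1)" .
qed

section \<open>Fourier modes of the quadratic form\<close>

text \<open>The coefficients of the binary quadratic form, dehomogenised at X = 1.\<close>

definition rs_form :: "nat \<Rightarrow> real \<Rightarrow> complex poly" where
  "rs_form k t = [:- rs_b k t, 2 * of_real (rs_a k t), cnj (rs_b k t):]"

text \<open>The rotation acts on the form by a linear change of variables: \<open>(X, Y)\<close>
  becomes \<open>(X + Y, X - Y)\<close>, with the second entry scaled by \<open>u\<close>.
  Dehomogenised, this is a Moebius map with pole -1, and the squared factor clears its
  denominator.\<close>

lemma rs_form_Suc_eval: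
  fixes y :: complex and k :: nat and t :: real
  assumes "y \<noteq> -1"
  defines "u \<equiv> cis (2 ^ k * t)"
  shows "poly (rs_form (Suc k) t) y =
           (- cnj u / 2) * ((1 + y)\<^sup>2 * poly (rs_form k t) (u * (1 - y) / (1 + y)))"
proof -
  define b where "b = cnj u * rs_b k t"
  have uu: "u * cnj u = 1" by (simp add: u_def cis_cnj cis_mult)
  have "cis (- (2 ^ k * t)) = cnj u" by (simp add: u_def cis_cnj)
  hence a': "rs_a (Suc k) t = Re b" and b': "rs_b (Suc k) t = of_real (rs_a k t) - \<i> * of_real (Im b)"
    by (simp_all add: rs_a_Suc rs_b_Suc b_def)
  define v where "v = u * (1 - y) / (1 + y)"
  have "1 + y \<noteq> 0" using assms(1) by (simp add: add_eq_0_iff)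
  hence v: "v * (1 + y) = u * (1 - y)" by (simp add: v_def)
  have "(1 + y)\<^sup>2 * poly (rs_form k t) v = - rs_b k t * (1 + y)\<^sup>2
      + 2 * of_real (rs_a k t) * (v * (1 + y)) * (1 + y) + cnj (rs_b k t) * (v * (1 + y))\<^sup>2"
    by (simp add: rs_form_def algebra_simps power2_eq_square)
  hence "(1 + y)\<^sup>2 * poly (rs_form k t) (u * (1 - y) / (1 + y)) =
     - rs_b k t * (1 + y)\<^sup>2 + 2 * of_real (rs_a k t) * u * (1 - y) * (1 + y) + cnj (rs_b k t) * u\<^sup>2 * (1 - y)\<^sup>2"
    unfolding v unfolding v_def by (simp add: power_mult_distrib mult_ac)
  also have "(- cnj u / 2) * \<dots> =
     (b * (1 + y)\<^sup>2 - 2 * of_real (rs_a k t) * (u * cnj u) * (1 - y) * (1 + y) - cnj b * (u * cnj u) * (1 - y)\<^sup>2) / 2"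
    by (simp add: b_def field_simps power2_eq_square)
  also have "\<dots> = ((b - cnj b) / 2) + (b + cnj b) * y + ((b - cnj b) / 2) * y\<^sup>2 - of_real (rs_a k t) * (1 - y\<^sup>2)"
    unfolding uu by (simp add: field_simps power2_eq_square)
  also have "b + cnj b = 2 * of_real (Re b)" by (simp add: complex_add_cnj)
  also have "b - cnj b = 2 * \<i> * of_real (Im b)" by (simp add: complex_diff_cnj)
  finally show ?thesis
    by (simp add: rs_form_def a' b' field_simps power2_eq_square)
qed

text \<open>Testing at real points lets the real identity \<open>kraw_sum\<close> serve for complex
  forms; -1 is left out as the pole of the substitution.\<close>

lemma poly_eqI_real_points:
  fixes p q :: "complex poly"
  assumes "\<And>y::real. y \<noteq> -1 \<Longrightarrow> poly p (of_real y) = poly q (of_real y)"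
  shows "p = q"
proof (rule ccontr)
  assume "p \<noteq> q"
  hence "finite {z. poly (p - q) z = 0}" by (intro poly_roots_finite) simp
  moreover have "of_real ` (UNIV - {-1 :: real}) \<subseteq> {z. poly (p - q) z = 0}" using assms by auto
  ultimately have "finite ((of_real :: real \<Rightarrow> complex) ` (UNIV - {-1}))" by (rule finite_subset[rotated])
  hence "finite (UNIV - {-1 :: real})" by (rule finite_imageD) (simp add: inj_on_def)
  thus False by (simp add: infinite_UNIV_char_0)
qed

lemma degree_rs_form_power: "degree (rs_form k t ^ l) \<le> 2 * l"
proof -
  have "degree (rs_form k t) \<le> 2" by (simp add: rs_form_def)
  thus ?thesis by (intro order.trans[OF degree_power_le]) simp
qed

text \<open>On forms of degree \<open>2 * l\<close> the substitution has the matrix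
  \<open>kraw (2 * l)\<close>. The phase joins \<open>u ^ i\<close> from the scaling with
  \<open>cnj u ^ l\<close> from the prefactor.\<close>

lemma coeff_rs_form_Suc_power:
  assumes "j \<le> 2 * l"
  shows "coeff (rs_form (Suc k) t ^ l) j =
    (\<Sum>i\<le>2*l. of_real ((-1/2) ^ l * kraw (2 * l) i j) *
       (cis (real_of_int (int i - int l) * (2 ^ k * t)) * coeff (rs_form k t ^ l) i))"
proof -
  define u where "u = cis (2 ^ k * t)"
  define w where "w i = coeff (rs_form k t ^ l) i" for i
  define R where "R = (\<Sum>j\<le>2*l. monom (\<Sum>i\<le>2*l. of_real ((-1/2) ^ l * kraw (2 * l) i j) * (cnj u ^ l * u ^ i * w i)) j)"
  have "rs_form (Suc k) t ^ l = R"
  proof (rule poly_eqI_real_points)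
    fix y :: real assume y: "y \<noteq> -1"
    let ?y = "of_real y :: complex"
    have y': "?y \<noteq> -1" using y by (metis of_real_1 of_real_eq_iff of_real_minus)
    hence y0: "1 + ?y \<noteq> 0" by (simp add: add_eq_0_iff)
    have "poly (rs_form (Suc k) t ^ l) ?y =
      (- cnj u / 2) ^ l * ((1 + ?y) ^ (2 * l) * poly (rs_form k t ^ l) (u * (1 - ?y) / (1 + ?y)))"
      by (simp only: poly_power rs_form_Suc_eval[OF y'] u_def[symmetric] power_mult_distrib power_mult)
    also have "poly (rs_form k t ^ l) (u * (1 - ?y) / (1 + ?y)) =
                 (\<Sum>i\<le>2*l. w i * (u * (1 - ?y) / (1 + ?y)) ^ i)"
      unfolding w_def by (rule poly_altdef_le[OF degree_rs_form_power])
    also have "(1 + ?y) ^ (2 * l) * \<dots> = (\<Sum>i\<le>2*l. w i * u ^ i * ((1 + ?y) ^ (2 * l - i) * (1 - ?y) ^ i))"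
      unfolding sum_distrib_left using y0
      by (intro sum.cong refl) (simp add: power_diff power_divide power_mult_distrib)
    also have "\<dots> = (\<Sum>i\<le>2*l. w i * u ^ i * of_real (\<Sum>j\<le>2*l. kraw (2 * l) i j * y ^ j))"
      by (intro sum.cong refl, subst kraw_sum) auto
    also have "\<dots> = (\<Sum>j\<le>2*l. \<Sum>i\<le>2*l. w i * u ^ i * of_real (kraw (2 * l) i j) * ?y ^ j)"
      by (simp add: sum_distrib_left mult_ac) (rule sum.swap)
    also have "(- cnj u / 2) ^ l = of_real ((-1/2) ^ l) * cnj u ^ l"
      by (simp flip: power_mult_distrib)
    finally show "poly (rs_form (Suc k) t ^ l) ?y = poly R ?y"
      by (simp add: R_def poly_sum poly_monom sum_distrib_left sum_distrib_right mult_ac)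
  qed
  hence "coeff (rs_form (Suc k) t ^ l) j = (\<Sum>i\<le>2*l. of_real ((-1/2) ^ l * kraw (2 * l) i j) * (cnj u ^ l * u ^ i * w i))"
    using assms by (simp only: R_def coeff_sum coeff_monom) simp
  moreover have "cnj u ^ l * u ^ i = cis (real_of_int (int i - int l) * (2 ^ k * t))" for i
    by (simp only: u_def cis_cnj Complex.DeMoivre cis_mult) (simp add: algebra_simps)
  ultimately show ?thesis by (simp add: w_def)
qed

section \<open>Fourier modes over one period\<close>

lemma continuous_coeff_power:
  fixes p :: "real \<Rightarrow> complex poly"
  assumes "\<And>i. continuous_on S (\<lambda>t. coeff (p t) i)"
  shows "continuous_on S (\<lambda>t. coeff (p t ^ l) i)"
proof (induction l arbitrary: i)
  case (Suc l)
  show ?case unfolding power_Suc coeff_mult by (intro continuous_intros assms Suc)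
qed simp

lemma continuous_coeff_rs_form_power: "continuous_on S (\<lambda>t. coeff (rs_form k t ^ l) i)"
proof (rule continuous_coeff_power)
  fix i show "continuous_on S (\<lambda>t. coeff (rs_form k t) i)"
    unfolding rs_form_def coeff_pCons rs_b_def
    by (cases i; cases "i - 1"; cases "i - 2") (auto intro!: continuous_intros continuous_rs_a)
qed

text \<open>Frequencies are counted in units of \<open>2 ^ k\<close>, the speed of the rotation in
  step \<open>k\<close>, so that the recursion acts on integers \<open>m\<close>. Real parts
  suffice: the recursion has real coefficients and the middle coefficient is real.\<close>

definition rs_mode :: "nat \<Rightarrow> nat \<Rightarrow> int \<Rightarrow> nat \<Rightarrow> real" where
  "rs_mode l k m i = integral {0..2*pi}
     (\<lambda>t. Re (cis (real_of_int m * (2 ^ k * t)) * coeff (rs_form k t ^ l) i))"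

lemma rs_mode_integrable:
  "(\<lambda>t. Re (cis (real_of_int m * (2 ^ k * t)) * coeff (rs_form k t ^ l) i)) integrable_on {0..2*pi}"
  by (intro integrable_continuous_interval continuous_intros continuous_coeff_rs_form_power)

lemma rs_mode_Suc:
  assumes "j \<le> 2 * l"
  shows "rs_mode l (Suc k) m j =
    (-1/2) ^ l * (\<Sum>i\<le>2*l. kraw (2 * l) i j * rs_mode l k (2 * m + int i - int l) i)"
proof -
  have "Re (cis (real_of_int m * (2 ^ Suc k * t)) * coeff (rs_form (Suc k) t ^ l) j) =
     (\<Sum>i\<le>2*l. ((-1/2) ^ l * kraw (2 * l) i j) *
        Re (cis (real_of_int (2 * m + int i - int l) * (2 ^ k * t)) * coeff (rs_form k t ^ l) i))" for t
  proof -
    have c: "cis (real_of_int m * (2 ^ Suc k * t)) * (of_real x * (cis (real_of_int (int i - int l) * (2 ^ k * t)) * z)) =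
          of_real x * (cis (real_of_int (2 * m + int i - int l) * (2 ^ k * t)) * z)" for x z i
    proof -
      have "cis (real_of_int m * (2 ^ Suc k * t)) * cis (real_of_int (int i - int l) * (2 ^ k * t)) =
            cis (real_of_int (2 * m + int i - int l) * (2 ^ k * t))"
        unfolding cis_mult by (simp add: algebra_simps)
      thus ?thesis by (metis mult.assoc mult.left_commute)
    qed
    show ?thesis
      unfolding coeff_rs_form_Suc_power[OF assms] sum_distrib_left c Re_sum by (intro sum.cong refl) (simp del: cis.simps)
  qed
  hence "rs_mode l (Suc k) m j = integral {0..2*pi} (\<lambda>t. \<Sum>i\<le>2*l. ((-1/2) ^ l * kraw (2 * l) i j) *
        Re (cis (real_of_int (2 * m + int i - int l) * (2 ^ k * t)) * coeff (rs_form k t ^ l) i))"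
    by (simp add: rs_mode_def)
  also have "\<dots> = (\<Sum>i\<le>2*l. ((-1/2) ^ l * kraw (2 * l) i j) * rs_mode l k (2 * m + int i - int l) i)"
    unfolding rs_mode_def
    by (subst integral_sum, simp, rule integrable_on_mult_right, rule rs_mode_integrable)
       (simp only: integral_mult_right)
  finally show ?thesis by (simp add: sum_distrib_left mult.assoc)
qed

text \<open>The region \<open>\<bar>m\<bar> \<ge> l\<close> is invariant, because there
  \<open>\<bar>2 * m + i - l\<bar> \<ge> 2 * l - l\<close>. At \<open>k = 0\<close> the form does
  not depend on \<open>t\<close>, and \<open>m\<close> is nonzero since \<open>l \<ge> 1\<close>, so
  the integral over the period vanishes.\<close>

lemma rs_mode_high:
  assumes "l \<ge> 1" "i \<le> 2 * l" "int l \<le> \<bar>m\<bar>"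
  shows "rs_mode l k m i = 0"
  using assms(2,3)
proof (induction k arbitrary: m i)
  case 0
  define w where "w = coeff ([:-1, 0, 1:] ^ l :: complex poly) i"
  have m: "m \<noteq> 0" using 0 assms(1) by auto
  have "((\<lambda>t. Re (cis (m * t) * w)) has_integral
      (sin (m * (2 * pi)) * Re w / m + cos (m * (2 * pi)) * Im w / m) -
      (sin (real_of_int m * 0) * Re w / m + cos (real_of_int m * 0) * Im w / m)) {0..2*pi}"
    using m by (intro fundamental_theorem_of_calculus)
      (auto intro!: derivative_eq_intros simp flip: has_real_derivative_iff_has_vector_derivative)
  moreover have "sin (m * (2 * pi)) = 0" "cos (m * (2 * pi)) = 1"
    using sin_int_2pin[of m] cos_int_2pin[of m] by (simp_all add: mult.commute)
  ultimately have "((\<lambda>t. Re (cis (m * t) * w)) has_integral 0) {0..2*pi}" by simp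
  hence "integral {0..2*pi} (\<lambda>t. Re (cis (m * t) * w)) = 0" by (rule integral_unique)
  moreover have "rs_form 0 t = [:-1, 0, 1:]" for t by (simp add: rs_form_def)
  ultimately show ?case unfolding rs_mode_def w_def by simp
next
  case (Suc k)
  have "rs_mode l k (2 * m + int i - int l) i = 0" if "i \<le> 2 * l" for i
    using that Suc.prems by (intro Suc.IH) auto
  thus ?case using Suc.prems by (simp add: rs_mode_Suc)
qed

lemma rs_mode_tendsto_0:
  assumes "l \<ge> 1" "i \<le> 2 * l"
  shows "(\<lambda>k. rs_mode l k m i) \<longlonglongrightarrow> 0"
  by (rule all_modes_tendsto_0[where l = l and c = "rs_mode l"])
     (rule rs_mode_Suc rs_mode_high assms | assumption)+

text \<open>The Legendre polynomial of degree \<open>l\<close> at \<open>2 * x - 1\<close>. The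
  powers of \<open>x\<close> and \<open>1 - x\<close> stand for the shares of P and Q in
  \<open>rs_norm_sum\<close>, and their products have beta integrals.\<close>

definition shifted_legendre :: "nat \<Rightarrow> real poly" where
  "shifted_legendre l = (\<Sum>j\<le>l. smult ((-1) ^ j * (real (l choose j))\<^sup>2) ([:0, 1:] ^ (l - j) * [:1, -1:] ^ j))"

lemma poly_shifted_legendre:
  "poly (shifted_legendre l) x = (\<Sum>j\<le>l. (-1) ^ j * (real (l choose j))\<^sup>2 * (x ^ (l - j) * (1 - x) ^ j))"
  by (simp add: shifted_legendre_def poly_sum poly_power)

text \<open>The form splits into two linear factors, with coefficients \<open>P, Q\<close> and
  \<open>- cnj Q, cnj P\<close>. In the middle coefficient of the power the binomial expansions pair
  \<open>P\<close> with \<open>cnj P\<close> and \<open>Q\<close> with \<open>cnj Q\<close>, so only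
  absolute values remain.\<close>

lemma coeff_rs_form_middle:
  "coeff (rs_form k t ^ l) l = of_real (2 ^ l * poly (shifted_legendre l) ((1 + rs_a k t) / 2))"
proof -
  define P Q where "P = rs_p k t" and "Q = rs_q k t"
  define N :: real where "N = 2 ^ Suc k"
  have N: "N > 0" by (simp add: N_def)
  have P: "(cmod P)\<^sup>2 / N = (1 + rs_a k t) / 2" and Q: "(cmod Q)\<^sup>2 / N = 1 - (1 + rs_a k t) / 2"
    by (simp_all add: P_def Q_def N_def cmod_rs_p cmod_rs_q field_simps)
  have "rs_form k t = smult (of_real (2 / N)) ([:P, Q:] * [:- cnj Q, cnj P:])"
  proof -
    have "2 * of_real (rs_a k t) = of_real (2 / N) * (P * cnj P - Q * cnj Q)"
      unfolding complex_norm_square[symmetric] of_real_diff[symmetric] of_real_mult[symmetric]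
      by (simp add: rs_a_def P_def Q_def N_def field_simps)
    moreover have "rs_b k t = of_real (2 / N) * (P * cnj Q)"
      by (simp add: rs_b_def P_def Q_def N_def)
    ultimately show ?thesis by (simp add: rs_form_def algebra_simps)
  qed
  hence "rs_form k t ^ l = smult (of_real (2 / N) ^ l) ([:P, Q:] ^ l * [:- cnj Q, cnj P:] ^ l)"
    by (simp only: smult_power power_mult_distrib)
  hence "coeff (rs_form k t ^ l) l =
     of_real (2 / N) ^ l * (\<Sum>j\<le>l. coeff ([:P, Q:] ^ l) j * coeff ([:- cnj Q, cnj P:] ^ l) (l - j))"
    by (simp add: coeff_mult)
  also have "(\<Sum>j\<le>l. coeff ([:P, Q:] ^ l) j * coeff ([:- cnj Q, cnj P:] ^ l) (l - j)) =
     (\<Sum>j\<le>l. of_real ((-1) ^ j * (real (l choose j))\<^sup>2 * (((cmod P)\<^sup>2) ^ (l - j) * ((cmod Q)\<^sup>2) ^ j)))"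
  proof (intro sum.cong refl)
    fix j assume "j \<in> {..l}"
    hence j: "j \<le> l" by simp
    hence b: "l choose (l - j) = l choose j" by (rule binomial_symmetric[symmetric])
    have "coeff ([:P, Q:] ^ l) j * coeff ([:- cnj Q, cnj P:] ^ l) (l - j) =
      (of_nat (l choose j) * Q ^ j * P ^ (l - j)) * (of_nat (l choose j) * cnj P ^ (l - j) * (- cnj Q) ^ j)"
      using j by (simp add: coeff_linear_poly_power b)
    also have "\<dots> = (-1) ^ j * (of_nat (l choose j))\<^sup>2 * ((P * cnj P) ^ (l - j) * (Q * cnj Q) ^ j)"
      by (subst power_minus[of "cnj Q"]) (simp only: power_mult_distrib power2_eq_square mult_ac)
    finally show "coeff ([:P, Q:] ^ l) j * coeff ([:- cnj Q, cnj P:] ^ l) (l - j) =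
       of_real ((-1) ^ j * (real (l choose j))\<^sup>2 * (((cmod P)\<^sup>2) ^ (l - j) * ((cmod Q)\<^sup>2) ^ j))"
      by (simp add: complex_norm_square[symmetric])
  qed
  also have "of_real (2 / N) ^ l * \<dots> = (of_real (2 ^ l * (\<Sum>j\<le>l. (-1) ^ j * (real (l choose j))\<^sup>2 *
      (((cmod P)\<^sup>2 / N) ^ (l - j) * ((cmod Q)\<^sup>2 / N) ^ j))) :: complex)"
  proof -
    have "(2 / N) ^ l * (\<Sum>j\<le>l. (-1) ^ j * (real (l choose j))\<^sup>2 * (((cmod P)\<^sup>2) ^ (l - j) * ((cmod Q)\<^sup>2) ^ j))
       = 2 ^ l * (\<Sum>j\<le>l. (-1) ^ j * (real (l choose j))\<^sup>2 * (((cmod P)\<^sup>2 / N) ^ (l - j) * ((cmod Q)\<^sup>2 / N) ^ j))"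
      unfolding sum_distrib_left
    proof (intro sum.cong refl)
      fix j assume "j \<in> {..l}"
      hence "N ^ l = N ^ (l - j) * N ^ j" by (simp flip: power_add)
      thus "(2 / N) ^ l * ((-1) ^ j * (real (l choose j))\<^sup>2 * (((cmod P)\<^sup>2) ^ (l - j) * ((cmod Q)\<^sup>2) ^ j))
        = 2 ^ l * ((-1) ^ j * (real (l choose j))\<^sup>2 * (((cmod P)\<^sup>2 / N) ^ (l - j) * ((cmod Q)\<^sup>2 / N) ^ j))"
        by (simp add: power_divide)
    qed
    from arg_cong[OF this, of complex_of_real] show ?thesis by simp
  qed
  finally show ?thesis by (simp only: P Q poly_shifted_legendre)
qed

section \<open>Equidistribution\<close>

text \<open>Induction on \<open>b\<close>, splitting one factor \<open>1 - x\<close> into its two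
  terms.\<close>

lemma has_integral_beta:
  "((\<lambda>x::real. x ^ a * (1 - x) ^ b) has_integral fact a * fact b / fact (a + b + 1)) {0..1}"
proof (induction b arbitrary: a)
  case 0
  have "((\<lambda>x::real. x ^ a) has_integral 1 ^ Suc a / real (Suc a) - 0 ^ Suc a / real (Suc a)) {0..1}"
    by (intro fundamental_theorem_of_calculus)
       (auto intro!: derivative_eq_intros simp del: of_nat_Suc power_Suc simp flip: has_real_derivative_iff_has_vector_derivative)
  moreover have "(fact a / fact (a + 1) :: real) = 1 / real (Suc a)" by simp
  ultimately show ?case by simp
next
  case (Suc b)
  have "((\<lambda>x::real. x ^ a * (1 - x) ^ b - x ^ Suc a * (1 - x) ^ b) has_integral
      fact a * fact b / fact (a + b + 1) - fact (Suc a) * fact b / fact (Suc a + b + 1)) {0..1}"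
    by (intro has_integral_diff Suc)
  moreover have "(\<lambda>x::real. x ^ a * (1 - x) ^ b - x ^ Suc a * (1 - x) ^ b) = (\<lambda>x. x ^ a * (1 - x) ^ Suc b)"
    by (simp add: algebra_simps)
  moreover have "fact a * fact b / fact (a + b + 1) - fact (Suc a) * fact b / fact (Suc a + b + 1) =
      (fact a * fact (Suc b) / fact (a + Suc b + 1) :: real)"
  proof -
    have "(fact (a + b + 2) :: real) = (real a + real b + 2) * fact (a + b + 1)"
      by (simp add: algebra_simps)
    thus ?thesis by (simp add: divide_simps) (simp add: algebra_simps)
  qed
  ultimately show ?case by simp
qed

text \<open>Each beta integral cancels one of the two binomial coefficients, which leaves an
  alternating row sum of Pascal's triangle divided by \<open>l + 1\<close>.\<close>

lemma integral_shifted_legendre: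
  assumes "l \<ge> 1"
  shows "integral {0..1} (poly (shifted_legendre l)) = 0"
proof -
  have "(poly (shifted_legendre l) has_integral
     (\<Sum>j\<le>l. (-1) ^ j * (real (l choose j))\<^sup>2 * (fact (l - j) * fact j / fact (l - j + j + 1)))) {0..1}"
    unfolding poly_shifted_legendre[abs_def]
    by (intro has_integral_sum has_integral_mult_right has_integral_beta) auto
  also have "(\<Sum>j\<le>l. (-1) ^ j * (real (l choose j))\<^sup>2 * (fact (l - j) * fact j / fact (l - j + j + 1))) =
             (\<Sum>j\<le>l. (-1) ^ j * real (l choose j)) / (real l + 1)"
    unfolding sum_divide_distrib
  proof (intro sum.cong refl)
    fix j assume "j \<in> {..l}"
    hence j: "j \<le> l" by simp
    have "real (l choose j) * (fact (l - j) * fact j) = fact l"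
      using j by (simp add: binomial_fact)
    hence "(real (l choose j))\<^sup>2 * (fact (l - j) * fact j) = real (l choose j) * fact l"
      by (simp add: power2_eq_square)
    moreover have "(fact (l - j + j + 1) :: real) = (real l + 1) * fact l" using j by simp
    ultimately show "(-1) ^ j * (real (l choose j))\<^sup>2 * (fact (l - j) * fact j / fact (l - j + j + 1)) =
       (-1) ^ j * real (l choose j) / (real l + 1)"
      by (simp add: mult.assoc)
  qed
  also have "\<dots> = 0" using assms by (simp add: choose_alternating_sum)
  finally show ?thesis by (rule integral_unique)
qed

lemma degree_shifted_legendre: "degree (shifted_legendre l) \<le> l"
  unfolding shifted_legendre_def
proof (intro degree_sum_le)
  fix j assume "j \<in> {..l}"
  hence j: "j \<le> l" by simp
  have "degree ([:0, 1:] ^ (l - j) * [:1, -1:] ^ j :: real poly) \<le> (l - j) + j"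
    by (intro order.trans[OF degree_mult_le] add_mono order.trans[OF degree_power_le]) auto
  thus "degree (smult ((-1) ^ j * (real (l choose j))\<^sup>2) ([:0, 1:] ^ (l - j) * [:1, -1:] ^ j)) \<le> l"
    using j by (intro order.trans[OF degree_smult_le]) simp
qed simp

text \<open>The sign of each summand cancels the leading sign of \<open>(1 - x) ^ j\<close>, leaving
  a sum of squares. So there is one such polynomial of each exact degree, as
  \<open>rs_a_equidistributed\<close> requires.\<close>

lemma coeff_shifted_legendre_pos: "coeff (shifted_legendre l) l > 0"
proof -
  have "coeff (shifted_legendre l) l = (\<Sum>j\<le>l. (real (l choose j))\<^sup>2)"
    unfolding shifted_legendre_def coeff_sum
  proof (intro sum.cong refl)
    fix j assume "j \<in> {..l}"
    hence j: "j \<le> l" by simp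
    have "[:0, 1:] ^ (l - j) = (monom 1 (l - j) :: real poly)" by (simp add: monom_altdef)
    hence "coeff ([:0, 1:] ^ (l - j) * [:1, -1:] ^ j :: real poly) l = (-1) ^ j"
      using j by (simp add: coeff_monom_mult coeff_linear_poly_power)
    thus "coeff (smult ((-1) ^ j * (real (l choose j))\<^sup>2) ([:0, 1:] ^ (l - j) * [:1, -1:] ^ j)) l = (real (l choose j))\<^sup>2"
      by simp
  qed
  also have "\<dots> > 0" by (intro sum_pos) auto
  finally show ?thesis .
qed

lemma poly_rs_a_integrable: "(\<lambda>t. poly p ((1 + rs_a k t) / 2)) integrable_on {0..2*pi}"
  by (intro integrable_continuous_interval continuous_intros continuous_rs_a) simp

text \<open>A multiple of the Legendre polynomial of the same degree removes the leading term of
  \<open>p\<close>. Along \<open>rs_a k\<close> that polynomial integrates to a multiple of a mode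
  of frequency 0, which tends to 0, and over \<open>{0..1}\<close> it integrates to 0. For constants
  both sides agree.\<close>

lemma rs_a_equidistributed:
  "(\<lambda>k. integral {0..2*pi} (\<lambda>t. poly p ((1 + rs_a k t) / 2))) \<longlonglongrightarrow> 2 * pi * integral {0..1} (poly p)"
proof (induction "degree p" arbitrary: p rule: less_induct)
  case less
  show ?case
  proof (cases "degree p")
    case 0
    then obtain c where "p = [:c:]" by (rule degree_eq_zeroE)
    hence "poly p = (\<lambda>_. c)" by auto
    thus ?thesis by simp
  next
    case (Suc n)
    define L where "L = shifted_legendre (Suc n)"
    define \<alpha> where "\<alpha> = coeff p (Suc n) / coeff L (Suc n)"
    define r where "r = p - smult \<alpha> L"
    have "coeff r i = 0" if "i > n" for i
    proof (cases "i = Suc n")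
      case True
      thus ?thesis using coeff_shifted_legendre_pos[of "Suc n"] by (simp add: r_def \<alpha>_def L_def)
    next
      case False
      thus ?thesis using that Suc degree_shifted_legendre[of "Suc n"]
        by (simp add: r_def L_def coeff_eq_0)
    qed
    hence "degree r < degree p" using Suc by (simp add: degree_le less_Suc_eq_le)
    hence IH: "(\<lambda>k. integral {0..2*pi} (\<lambda>t. poly r ((1 + rs_a k t) / 2))) \<longlonglongrightarrow> 2 * pi * integral {0..1} (poly r)"
      by (rule less)
    have mode: "integral {0..2*pi} (\<lambda>t. poly L ((1 + rs_a k t) / 2)) = rs_mode (Suc n) k 0 (Suc n) / 2 ^ Suc n" for k
    proof -
      have "rs_mode (Suc n) k 0 (Suc n) = integral {0..2*pi} (\<lambda>t. 2 ^ Suc n * poly L ((1 + rs_a k t) / 2))"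
        unfolding rs_mode_def coeff_rs_form_middle L_def by simp
      also have "\<dots> = 2 ^ Suc n * integral {0..2*pi} (\<lambda>t. poly L ((1 + rs_a k t) / 2))"
        by (rule integral_mult_right)
      finally show ?thesis by simp
    qed
    have p: "p = r + smult \<alpha> L" by (simp add: r_def)
    have "integral {0..2*pi} (\<lambda>t. poly p ((1 + rs_a k t) / 2)) =
          integral {0..2*pi} (\<lambda>t. poly r ((1 + rs_a k t) / 2)) + \<alpha> * (rs_mode (Suc n) k 0 (Suc n) / 2 ^ Suc n)" for k
    proof -
      have "integral {0..2*pi} (\<lambda>t. poly p ((1 + rs_a k t) / 2)) =
        integral {0..2*pi} (\<lambda>t. poly r ((1 + rs_a k t) / 2) + \<alpha> * poly L ((1 + rs_a k t) / 2))"
        by (simp add: p)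
      also have "\<dots> = integral {0..2*pi} (\<lambda>t. poly r ((1 + rs_a k t) / 2)) +
           integral {0..2*pi} (\<lambda>t. \<alpha> * poly L ((1 + rs_a k t) / 2))"
        by (intro Henstock_Kurzweil_Integration.integral_add poly_rs_a_integrable integrable_on_mult_right)
      finally show ?thesis by (simp add: mode)
    qed
    moreover have "(\<lambda>k. integral {0..2*pi} (\<lambda>t. poly r ((1 + rs_a k t) / 2)) + \<alpha> * (rs_mode (Suc n) k 0 (Suc n) / 2 ^ Suc n))
        \<longlonglongrightarrow> 2 * pi * integral {0..1} (poly r) + \<alpha> * (0 / 2 ^ Suc n)"
      by (intro tendsto_intros IH rs_mode_tendsto_0) auto
    moreover have "integral {0..1} (poly p) = integral {0..1} (poly r)"
    proof -
      have c: "poly q integrable_on {0..1}" for q :: "real poly"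
        by (intro integrable_continuous_interval continuous_intros)
      have "integral {0..1} (poly p) = integral {0..1} (\<lambda>x. poly r x + \<alpha> * poly L x)"
        by (intro integral_cong) (simp add: p)
      also have "\<dots> = integral {0..1} (poly r) + integral {0..1} (\<lambda>x. \<alpha> * poly L x)"
        by (intro Henstock_Kurzweil_Integration.integral_add c integrable_on_mult_right)
      finally show ?thesis by (simp add: L_def integral_shifted_legendre)
    qed
    ultimately show ?thesis by simp
  qed
qed

text \<open>A one-sided approximation to the indicator of a band; it turns convergence of moments
  into an upper bound for the time spent in the band.\<close>

lemma polynomial_majorant:
  fixes \<eta> \<delta> :: real
  assumes "\<eta> \<ge> 0" "\<delta> > 0"
  obtains p :: "real poly" where "\<And>x. x \<in> {0..1} \<Longrightarrow> 0 \<le> poly p x"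
    "\<And>x. x \<in> {0..1} \<Longrightarrow> \<bar>2 * x - 1\<bar> \<le> \<eta> \<Longrightarrow> 1 \<le> poly p x"
    "integral {0..1} (poly p) \<le> \<eta> + \<delta>"
proof -
  \<comment> \<open>One \<open>e\<close> pays for the ramps of the trapezoid \<open>\<psi>\<close>,
    two for the polynomial: it approximates \<open>\<psi> + e\<close> within \<open>e\<close> and so
    lies between \<open>\<psi>\<close> and \<open>\<psi> + 2 * e\<close>.\<close>
  define e where "e = \<delta> / 3"
  have e: "e > 0" using assms by (simp add: e_def)
  define \<psi> where "\<psi> x = max 0 (min 1 (1 + (\<eta> - \<bar>2 * x - 1\<bar>) / e))" for x
  have cont: "continuous_on S \<psi>" for S
    unfolding \<psi>_def using e by (intro continuous_intros) auto
  define lo hi where "lo = max 0 ((1 - \<eta> - e) / 2)" and "hi = min 1 ((1 + \<eta> + e) / 2)"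
  have lohi: "0 \<le> lo" "lo \<le> hi" "hi \<le> 1" using assms(1) e by (auto simp: lo_def hi_def max_def min_def)
  have "integral {0..1} \<psi> \<le> integral {0..1} (\<lambda>x. if x \<in> {lo..hi} then 1 else 0)"
  proof (rule integral_le)
    show "(\<lambda>x. if x \<in> {lo..hi} then 1 else 0 :: real) integrable_on {0..1}"
      using lohi by (subst integrable_restrict_Int) (simp add: Int_absorb2 integrable_const_ivl)
    fix x :: real assume "x \<in> {0..1}"
    show "\<psi> x \<le> (if x \<in> {lo..hi} then 1 else 0)"
    proof (cases "x \<in> {lo..hi}")
      case False
      hence "\<eta> - \<bar>2 * x - 1\<bar> \<le> - e" using \<open>x \<in> {0..1}\<close> by (auto simp: lo_def hi_def)
      hence "(\<eta> - \<bar>2 * x - 1\<bar>) / e \<le> -1" using e by (simp add: pos_divide_le_eq)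
      thus ?thesis unfolding if_not_P[OF False] by (simp add: \<psi>_def)
    qed (simp add: \<psi>_def)
  qed (intro integrable_continuous_interval cont)
  also have "\<dots> = integral {lo..hi} (\<lambda>x. 1)"
    using lohi by (subst integral_restrict_Int) (simp add: Int_absorb2)
  also have "\<dots> = hi - lo" using lohi by simp
  also have "\<dots> \<le> (1 + \<eta> + e) / 2 - (1 - \<eta> - e) / 2"
    unfolding lo_def hi_def by (intro diff_mono min.cobounded2 max.cobounded2)
  also have "\<dots> = \<eta> + e" by (simp add: field_simps)
  finally have int: "integral {0..1} \<psi> \<le> \<eta> + e" .
  have "continuous_on {0..1} (\<lambda>x. \<psi> x + e)" by (intro continuous_intros cont)
  from Stone_Weierstrass_real_polynomial_function[OF compact_Icc this e]
  obtain g where g: "real_polynomial_function g" "\<And>x. x \<in> {0..1} \<Longrightarrow> \<bar>\<psi> x + e - g x\<bar> < e"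
    by blast
  from g(1) obtain a n where g_eq: "g = (\<lambda>x. \<Sum>i\<le>n. a i * x ^ i)"
    unfolding real_polynomial_function_iff_sum by blast
  define p where "p = (\<Sum>i\<le>n. monom (a i) i)"
  have p: "poly p x = g x" for x by (simp add: p_def g_eq poly_sum poly_monom)
  have bounds: "\<psi> x \<le> poly p x" "poly p x \<le> \<psi> x + 2 * e" if "x \<in> {0..1}" for x
    using g(2)[OF that] by (auto simp: p abs_less_iff)
  show ?thesis
  proof (rule that[of p])
    show "0 \<le> poly p x" if "x \<in> {0..1}" for x
      using bounds(1)[OF that] by (auto simp: \<psi>_def intro: order.trans)
    show "1 \<le> poly p x" if "x \<in> {0..1}" "\<bar>2 * x - 1\<bar> \<le> \<eta>" for x
    proof -
      have "\<psi> x = 1" using that(2) e by (simp add: \<psi>_def)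
      thus ?thesis using bounds(1)[OF that(1)] by simp
    qed
    have "integral {0..1} (poly p) \<le> integral {0..1} (\<lambda>x. \<psi> x + 2 * e)"
      by (intro integral_le integrable_continuous_interval continuous_intros cont bounds)
    also have "\<dots> = integral {0..1} \<psi> + integral {0..1} (\<lambda>x::real. 2 * e)"
      by (intro Henstock_Kurzweil_Integration.integral_add integrable_continuous_interval continuous_intros cont)
    also have "\<dots> \<le> \<eta> + \<delta>" using int by (simp add: e_def)
    finally show "integral {0..1} (poly p) \<le> \<eta> + \<delta>" .
  qed
qed

section \<open>Counting level crossings\<close>

lemma level_between:
  fixes f :: "real \<Rightarrow> real"
  assumes "p < q" "continuous_on {p..q} f" "f p < v \<and> v < f q \<or> f q < v \<and> v < f p"
  obtains t where "p < t" "t < q" "f t = v"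
proof -
  have "\<exists>t. p \<le> t \<and> t \<le> q \<and> f t = v"
    using assms IVT'[of f p v q] IVT2'[of f q v p] by auto
  then obtain t where t: "p \<le> t" "t \<le> q" "f t = v" by blast
  hence "t \<noteq> p" "t \<noteq> q" using assms(3) by auto
  thus ?thesis using t by (intro that) auto
qed

text \<open>If \<open>g p = f p\<close> and \<open>g q = - f q\<close>, the terms on the left say
  that \<open>g\<close> ends on the same side of \<open>c\<close>, respectively of
  \<open>- c\<close>, as it starts. Comparing the positions of \<open>f p\<close> and
  \<open>f q\<close> above, between or below the levels, each such failure is paid for by a crossing
  of \<open>f\<close>, or both by \<open>f\<close> staying in the band.\<close>

lemma two_level_count:
  fixes f :: "real \<Rightarrow> real" and c :: real
  defines "r \<equiv> \<lambda>v p q. card {t. p < t \<and> t < q \<and> f t = v}"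
  assumes pq: "p < q" and cont: "continuous_on {p..q} f" and "c > 0"
    and ends: "\<bar>f p\<bar> \<noteq> c" "\<bar>f q\<bar> \<noteq> c"
    and fin: "\<And>v. finite {t. p < t \<and> t < q \<and> f t = v}"
  shows "of_bool ((f p > c) = (f q < - c)) + of_bool ((f p < - c) = (f q > c))
     \<le> r c p q + r (- c) p q + 2 * of_bool (\<forall>t\<in>{p..q}. \<bar>f t\<bar> \<le> c)"
proof -
  have r1: "1 \<le> r v p q" if "p < t" "t < q" "f t = v" for t v
  proof -
    have "{t. p < t \<and> t < q \<and> f t = v} \<noteq> {}" using that by auto
    thus ?thesis unfolding r_def using fin[of v] by (simp add: Suc_le_eq card_gt_0_iff)
  qed
  have cross: "1 \<le> r v p q" if "f p < v \<and> v < f q \<or> f q < v \<and> v < f p" for v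
    using level_between[OF pq cont that] r1 by metis
  have up: "1 \<le> r c p q" if "(f p > c) \<noteq> (f q > c)"
    using that ends \<open>c > 0\<close> by (intro cross) linarith
  have down: "1 \<le> r (- c) p q" if "(f p < - c) \<noteq> (f q < - c)"
    using that ends \<open>c > 0\<close> by (intro cross) linarith
  have two: "2 \<le> r v p q" if s: "p < s" "s < q" "f p < v \<and> v < f s \<and> f q < v \<or> v < f p \<and> f s < v \<and> v < f q" for s v
  proof -
    have c1: "continuous_on {p..s} f" and c2: "continuous_on {s..q} f"
      using s(1,2) by (auto intro: continuous_on_subset[OF cont])
    obtain t1 where t1: "p < t1" "t1 < s" "f t1 = v"
      using level_between[OF s(1) c1, of v] s(3) by metis
    obtain t2 where t2: "s < t2" "t2 < q" "f t2 = v"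
      using level_between[OF s(2) c2, of v] s(3) by metis
    have "card {t1, t2} \<le> r v p q"
      unfolding r_def using t1 t2 by (intro card_mono fin) auto
    thus ?thesis using t1 t2 by auto
  qed
  \<comment> \<open>With both ends in the band the left side is 2; if \<open>f\<close> leaves the
    band in between, it meets the level it leaves by once on the way out and once on the way
    back.\<close>
  have mid: "2 \<le> r c p q + r (- c) p q"
    if "\<bar>f p\<bar> \<le> c" "\<bar>f q\<bar> \<le> c" "\<not> (\<forall>t\<in>{p..q}. \<bar>f t\<bar> \<le> c)"
  proof -
    from that(3) obtain s where s: "p \<le> s" "s \<le> q" "\<bar>f s\<bar> > c" by auto
    have "s \<noteq> p" "s \<noteq> q" using s that by auto
    hence s': "p < s" "s < q" using s by auto
    have lt: "\<bar>f p\<bar> < c" "\<bar>f q\<bar> < c" using that ends by auto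
    show ?thesis
    proof (cases "f s > c")
      case True
      hence "2 \<le> r c p q" using lt by (intro two[OF s']) auto
      thus ?thesis by simp
    next
      case False
      hence "f s < - c" using s(3) by auto
      hence "2 \<le> r (- c) p q" using lt by (intro two[OF s']) auto
      thus ?thesis by simp
    qed
  qed
  have "\<not> (f p > c \<and> f p < - c)" "\<not> (f q > c \<and> f q < - c)" using \<open>c > 0\<close> by auto
  moreover have "\<bar>f p\<bar> \<le> c" if "\<not> f p > c" "\<not> f p < - c" using that by auto
  moreover have "\<bar>f q\<bar> \<le> c" if "\<not> f q > c" "\<not> f q < - c" using that by auto
  moreover define K where "K \<longleftrightarrow> (\<forall>t\<in>{p..q}. \<bar>f t\<bar> \<le> c)"
  ultimately show ?thesis using up down mid unfolding K_def[symmetric]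
    by (cases K; cases "f p > c"; cases "f p < - c"; cases "f q > c"; cases "f q < - c") simp_all
qed

text \<open>A solution lies in at most two of the closed intervals: number \<open>u t\<close>, and
  the preceding one \<open>w t\<close> if it is a division point. The predecessor is cyclic, so that
  the solution 0 also serves for \<open>2 * pi\<close>.\<close>

lemma interval_solutions_count:
  fixes g :: "real \<Rightarrow> real" and n :: nat
  defines "\<tau> \<equiv> \<lambda>j::nat. 2 * pi * real j / real n"
  assumes per: "\<And>t. g (t + 2 * pi) = g t"
    and fin: "finite {t. 0 \<le> t \<and> t < 2 * pi \<and> g t = v}"
    and X: "X \<subseteq> {..<n}" "\<And>j. j \<in> X \<Longrightarrow> \<exists>t\<in>{\<tau> j..\<tau> (Suc j)}. g t = v"
  shows "card X \<le> 2 * card {t. 0 \<le> t \<and> t < 2 * pi \<and> g t = v}"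
proof -
  define Z where "Z = {t. 0 \<le> t \<and> t < 2 * pi \<and> g t = v}"
  define u where "u t = nat \<lfloor>t * real n / (2 * pi)\<rfloor>" for t
  define w where "w t = (u t + n - 1) mod n" for t
  have u: "u t = j" if "\<tau> j \<le> t" "t < \<tau> (Suc j)" "j < n" for t j
  proof -
    have "real j \<le> t * real n / (2 * pi)" "t * real n / (2 * pi) < real j + 1"
      using that by (auto simp: \<tau>_def field_simps)
    hence "\<lfloor>t * real n / (2 * pi)\<rfloor> = int j" by (intro floor_unique) auto
    thus ?thesis by (simp add: u_def)
  qed
  have "X \<subseteq> u ` Z \<union> w ` Z"
  proof
    fix j assume j: "j \<in> X"
    hence jn: "j < n" using X by auto
    have \<tau>0: "0 \<le> \<tau> i" for i by (simp add: \<tau>_def)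
    have \<tau>m: "\<tau> i < \<tau> i'" if "i < i'" for i i'
      using that jn by (simp add: \<tau>_def divide_strict_right_mono)
    have \<tau>n: "\<tau> n = 2 * pi" using jn by (simp add: \<tau>_def)
    obtain t where t: "\<tau> j \<le> t" "t \<le> \<tau> (Suc j)" "g t = v" using X(2)[OF j] by auto
    consider "t < \<tau> (Suc j)" | "t = \<tau> (Suc j)" "Suc j < n" | "t = \<tau> (Suc j)" "Suc j = n"
      using t jn by linarith
    thus "j \<in> u ` Z \<union> w ` Z"
    proof cases
      case 1
      have "\<tau> (Suc j) \<le> \<tau> n" using jn \<tau>m[of "Suc j" n] by (cases "Suc j = n") auto
      hence "t \<in> Z" using t 1 \<tau>n \<tau>0[of j] by (simp add: Z_def)
      thus ?thesis using u[of j t] t 1 jn by auto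
    next
      case 2
      have "t \<in> Z" using t 2 \<tau>n \<tau>0[of j] \<tau>m[of "Suc j" n] by (simp add: Z_def)
      moreover have "u t = Suc j" using 2 \<tau>m[of "Suc j" "Suc (Suc j)"] by (intro u) auto
      hence "w t = j" using jn by (simp add: w_def)
      ultimately show ?thesis by auto
    next
      case 3
      have "g 0 = v" using t(3) 3 \<tau>n per[of 0] by simp
      hence "0 \<in> Z" by (simp add: Z_def)
      moreover have "w 0 = j" using 3 by (auto simp: w_def u_def)
      ultimately show ?thesis by auto
    qed
  qed
  hence "card X \<le> card (u ` Z \<union> w ` Z)" using fin by (intro card_mono) (auto simp: Z_def)
  also have "\<dots> \<le> card (u ` Z) + card (w ` Z)" by (rule card_Un_le)
  also have "\<dots> \<le> card Z + card Z" using fin by (intro add_mono card_image_le) (auto simp: Z_def)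
  finally show ?thesis by (simp add: Z_def)
qed

text \<open>Of the \<open>2 * n\<close> pairs of an interval and a level, those where
  \<open>g\<close> does not change sides are charged by \<open>two_level_count\<close> to crossings
  of \<open>f\<close>, at most \<open>n / 2\<close> per level, and twice to each interval on which
  \<open>f\<close> stays in the band. The integral of \<open>\<phi>\<close> bounds the number of the
  latter; every other pair forces a solution for \<open>g\<close>.\<close>

lemma alternating_sample_count:
  fixes f g \<phi> :: "real \<Rightarrow> real" and n :: nat and \<eta> \<delta> \<kappa> :: real
  defines "\<tau> \<equiv> \<lambda>j::nat. 2 * pi * real j / real n"
    and "Z \<equiv> \<lambda>h v. {t. 0 \<le> t \<and> t < 2 * pi \<and> h t = v}"
  assumes n: "n \<ge> 1" and cf: "continuous_on UNIV f" and cg: "continuous_on UNIV g"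
    and per: "\<And>t. g (t + 2 * pi) = g t"
    and sample: "\<And>j. g (\<tau> j) = (-1) ^ j * f (\<tau> j)"
    and finf: "\<And>v. finite (Z f v)" and cardf: "\<And>v. 2 * card (Z f v) \<le> n"
    and fing: "\<And>v. finite (Z g v)"
    and \<eta>: "0 \<le> \<eta>" and \<delta>: "0 < \<delta>"
    and cphi: "continuous_on {0..2*pi} \<phi>" and phi0: "\<And>t. 0 \<le> \<phi> t"
    and phi1: "\<And>t. \<bar>f t\<bar> \<le> \<eta> + \<delta> \<Longrightarrow> 1 \<le> \<phi> t"
    and int: "integral {0..2*pi} \<phi> \<le> 2 * pi * \<kappa>"
  shows "real n - 2 * \<kappa> * real n \<le> 2 * real (card (Z g \<eta>)) + 2 * real (card (Z g (- \<eta>)))"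
proof -
  have \<tau>0: "\<tau> 0 = 0" and \<tau>n: "\<tau> n = 2 * pi" using n by (auto simp: \<tau>_def)
  have \<tau>Suc: "\<tau> (Suc j) - \<tau> j = 2 * pi / real n" for j
    by (simp add: \<tau>_def algebra_simps flip: diff_divide_distrib)
  have \<tau>le: "\<tau> i \<le> \<tau> j" if "i \<le> j" for i j
    using that n by (simp add: \<tau>_def divide_right_mono)
  have \<tau>lt: "\<tau> j < \<tau> (Suc j)" for j
    using \<tau>Suc[of j] n by (metis diff_gt_0_iff_gt divide_pos_pos of_nat_0_less_iff pi_gt_zero
        zero_less_mult_iff zero_less_numeral less_eq_Suc_le One_nat_def)
  \<comment> \<open>Moving the level from \<eta> to a slightly larger c changes none of the comparisons
      at the sample points, but makes them strict.\<close>
  obtain c where c: "\<eta> < c" "c \<le> \<eta> + \<delta>" "\<And>j. j \<le> n \<Longrightarrow> \<bar>f (\<tau> j)\<bar> > \<eta> \<Longrightarrow> \<bar>f (\<tau> j)\<bar> > c"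
  proof -
    define D where "D = insert (\<eta> + \<delta>) ((\<lambda>j. \<bar>f (\<tau> j)\<bar>) ` {j. j \<le> n \<and> \<bar>f (\<tau> j)\<bar> > \<eta>})"
    have D0: "\<eta> + \<delta> \<in> D" by (simp add: D_def)
    have D: "finite D" "D \<noteq> {}" by (auto simp: D_def)
    have "Min D \<in> D" by (rule Min_in[OF D])
    hence M: "Min D > \<eta>" using \<delta> by (auto simp: D_def)
    have le: "Min D \<le> x" if "x \<in> D" for x using D that by simp
    show ?thesis
    proof (rule that[of "(\<eta> + Min D) / 2"])
      show "(\<eta> + Min D) / 2 \<le> \<eta> + \<delta>" using le[OF D0] \<delta> by simp
      show "(\<eta> + Min D) / 2 < \<bar>f (\<tau> j)\<bar>" if "j \<le> n" "\<bar>f (\<tau> j)\<bar> > \<eta>" for j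
      proof -
        have "\<bar>f (\<tau> j)\<bar> \<in> D" using that by (auto simp: D_def)
        from le[OF this] M that show ?thesis by simp
      qed
    qed (use M in simp)
  qed
  have gt: "f (\<tau> j) > c \<longleftrightarrow> f (\<tau> j) > \<eta>" and lt: "f (\<tau> j) < - c \<longleftrightarrow> f (\<tau> j) < - \<eta>"
    and ne: "\<bar>f (\<tau> j)\<bar> \<noteq> c" if "j \<le> n" for j
    using c(1) c(3)[OF that] \<eta> by (auto simp: abs_if split: if_splits)
  \<comment> \<open>The comparison is strict on one side only, so the solution may be an endpoint;
    this is why closed intervals are counted.\<close>
  define Xp where "Xp = {j. j < n \<and> (g (\<tau> j) > \<eta>) \<noteq> (g (\<tau> (Suc j)) > \<eta>)}"
  define Xm where "Xm = {j. j < n \<and> (g (\<tau> j) < - \<eta>) \<noteq> (g (\<tau> (Suc j)) < - \<eta>)}"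
  have ivt: "\<exists>t\<in>{\<tau> j..\<tau> (Suc j)}. g t = v"
    if "g (\<tau> j) \<le> v \<and> v \<le> g (\<tau> (Suc j)) \<or> g (\<tau> (Suc j)) \<le> v \<and> v \<le> g (\<tau> j)" for j v
    using that IVT'[of g "\<tau> j" v "\<tau> (Suc j)"] IVT2'[of g "\<tau> (Suc j)" v "\<tau> j"]
      \<tau>lt[of j] continuous_on_subset[OF cg subset_UNIV] by fastforce
  have Xp: "card Xp \<le> 2 * card (Z g \<eta>)"
    unfolding Z_def
  proof (rule interval_solutions_count[where n = n, OF per fing[unfolded Z_def]], goal_cases)
    case (2 j)
    hence "\<exists>t\<in>{\<tau> j..\<tau> (Suc j)}. g t = \<eta>" by (intro ivt) (auto simp: Xp_def)
    thus ?case by (simp only: \<tau>_def)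
  qed (auto simp: Xp_def)
  have Xm: "card Xm \<le> 2 * card (Z g (- \<eta>))"
    unfolding Z_def
  proof (rule interval_solutions_count[where n = n, OF per fing[unfolded Z_def]], goal_cases)
    case (2 j)
    hence "\<exists>t\<in>{\<tau> j..\<tau> (Suc j)}. g t = (- \<eta>)" by (intro ivt) (auto simp: Xm_def)
    thus ?case by (simp only: \<tau>_def)
  qed (auto simp: Xm_def)
  define r where "r v j = card {t. \<tau> j < t \<and> t < \<tau> (Suc j) \<and> f t = v}" for v j
  define C where "C = {j. j < n \<and> (\<forall>t\<in>{\<tau> j..\<tau> (Suc j)}. \<bar>f t\<bar> \<le> c)}"
  have sub: "{t. \<tau> j < t \<and> t < \<tau> (Suc j) \<and> f t = v} \<subseteq> Z f v" if "j < n" for j v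
    using that \<tau>le[of 0 j] \<tau>le[of "Suc j" n] \<tau>0 \<tau>n by (auto simp: Z_def)
  have rsum: "2 * (\<Sum>j<n. r v j) \<le> n" for v
  proof -
    have "(\<Sum>j<n. r v j) = card (\<Union>j\<in>{..<n}. {t. \<tau> j < t \<and> t < \<tau> (Suc j) \<and> f t = v})"
      unfolding r_def
    proof (rule card_UN_disjoint[symmetric])
      show "\<forall>j\<in>{..<n}. finite {t. \<tau> j < t \<and> t < \<tau> (Suc j) \<and> f t = v}"
        by (intro ballI finite_subset[OF sub finf]) auto
      have "{t. \<tau> i < t \<and> t < \<tau> (Suc i) \<and> f t = v} \<inter> {t. \<tau> j < t \<and> t < \<tau> (Suc j) \<and> f t = v} = {}"
        if "i < j" for i j using \<tau>le[of "Suc i" j] that by auto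
      thus "\<forall>i\<in>{..<n}. \<forall>j\<in>{..<n}. i \<noteq> j \<longrightarrow>
        {t. \<tau> i < t \<and> t < \<tau> (Suc i) \<and> f t = v} \<inter> {t. \<tau> j < t \<and> t < \<tau> (Suc j) \<and> f t = v} = {}"
        by (metis (no_types, lifting) Int_commute linorder_neqE_nat)
    qed simp
    also have "\<dots> \<le> card (Z f v)" using sub by (intro card_mono finf) auto
    finally show ?thesis using cardf[of v] by linarith
  qed
  have bad: "of_bool (j \<notin> Xp) + of_bool (j \<notin> Xm) \<le> r c j + r (- c) j + 2 * of_bool (j \<in> C)" if j: "j < n" for j
  proof -
    have fin: "finite {t. \<tau> j < t \<and> t < \<tau> (Suc j) \<and> f t = v}" for v
      using sub[OF j] finf by (rule finite_subset)
    have "of_bool ((f (\<tau> j) > c) = (f (\<tau> (Suc j)) < - c)) + of_bool ((f (\<tau> j) < - c) = (f (\<tau> (Suc j)) > c))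
       \<le> r c j + r (- c) j + 2 * of_bool (j \<in> C)"
      using two_level_count[OF \<tau>lt continuous_on_subset[OF cf subset_UNIV] _ ne ne fin] j c(1) \<eta>
      by (simp add: r_def C_def)
    \<comment> \<open>Exactly one of the two neighbouring samples has its sign flipped. For even
      \<open>j\<close> the two failures are the two comparisons in this order, for odd
      \<open>j\<close> in the other, which the sum does not see.\<close>
    moreover have "(of_bool (j \<notin> Xp) + of_bool (j \<notin> Xm) :: nat) =
       of_bool ((f (\<tau> j) > c) = (f (\<tau> (Suc j)) < - c)) + of_bool ((f (\<tau> j) < - c) = (f (\<tau> (Suc j)) > c))"
    proof -
      have j': "j \<le> n" "Suc j \<le> n" using j by auto
      show ?thesis
      proof (cases "even j")
        case True
        hence "(j \<notin> Xp) = ((f (\<tau> j) > \<eta>) = (f (\<tau> (Suc j)) < - \<eta>))"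
              "(j \<notin> Xm) = ((f (\<tau> j) < - \<eta>) = (f (\<tau> (Suc j)) > \<eta>))"
          using j by (auto simp: Xp_def Xm_def sample)
        thus ?thesis by (simp only: gt[OF j'(1)] gt[OF j'(2)] lt[OF j'(1)] lt[OF j'(2)])
      next
        case False
        hence "(j \<notin> Xp) = ((f (\<tau> j) < - \<eta>) = (f (\<tau> (Suc j)) > \<eta>))"
              "(j \<notin> Xm) = ((f (\<tau> j) > \<eta>) = (f (\<tau> (Suc j)) < - \<eta>))"
          using j by (auto simp: Xp_def Xm_def sample)
        thus ?thesis by (simp only: gt[OF j'(1)] gt[OF j'(2)] lt[OF j'(1)] lt[OF j'(2)] add.commute)
      qed
    qed
    ultimately show ?thesis by simp
  qed
  have count: "(\<Sum>j<n. of_bool (j \<in> S)) = card S" if "S \<subseteq> {..<n}" for S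
    using that by (simp add: Int_absorb1)
  have co: "(\<Sum>j<n. of_bool (j \<notin> S)) + card S = n" if "S \<subseteq> {..<n}" for S
  proof -
    have "(\<Sum>j<n. of_bool (j \<notin> S)) + (\<Sum>j<n. of_bool (j \<in> S)) = (\<Sum>j<n. 1 :: nat)"
      unfolding sum.distrib[symmetric] by (intro sum.cong) auto
    thus ?thesis using count[OF that] by simp
  qed
  have "(\<Sum>j<n. of_bool (j \<notin> Xp) + of_bool (j \<notin> Xm)) \<le> (\<Sum>j<n. r c j + r (- c) j + 2 * of_bool (j \<in> C))"
    by (intro sum_mono bad) simp
  also have "\<dots> = (\<Sum>j<n. r c j) + (\<Sum>j<n. r (- c) j) + 2 * (\<Sum>j<n. of_bool (j \<in> C))"
    by (simp only: sum.distrib sum_distrib_left)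
  also have "(\<Sum>j<n. of_bool (j \<in> C)) = card C" by (rule count) (auto simp: C_def)
  also have "(\<Sum>j<n. r c j) + (\<Sum>j<n. r (- c) j) + 2 * card C \<le> n + 2 * card C"
    using rsum[of c] rsum[of "- c"] by linarith
  finally have "(\<Sum>j<n. of_bool (j \<notin> Xp)) + (\<Sum>j<n. of_bool (j \<notin> Xm)) \<le> n + 2 * card C"
    by (simp only: sum.distrib)
  moreover have "(\<Sum>j<n. of_bool (j \<notin> Xp)) + card Xp = n" "(\<Sum>j<n. of_bool (j \<notin> Xm)) + card Xm = n"
    by (rule co, force simp: Xp_def Xm_def)+
  ultimately have main: "n \<le> card Xp + card Xm + 2 * card C" by linarith
  \<comment> \<open>On an interval of \<open>C\<close> the bound
    \<open>c \<le> \<eta> + \<delta>\<close> gives \<open>\<phi> \<ge> 1\<close>, so it contributes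
    at least its length.\<close>
  have "real (card C) * (2 * pi / real n) \<le> integral {0..2*pi} \<phi>"
  proof -
    have io: "\<phi> integrable_on {\<tau> i..\<tau> j}" if "j \<le> n" for i j
      using \<tau>le[of 0 i] \<tau>le[OF that] \<tau>0 \<tau>n
      by (intro integrable_continuous_interval continuous_on_subset[OF cphi]) auto
    have split: "(\<Sum>j<m. integral {\<tau> j..\<tau> (Suc j)} \<phi>) = integral {\<tau> 0..\<tau> m} \<phi>" if "m \<le> n" for m
      using that
    proof (induction m)
      case (Suc m)
      have "integral {\<tau> 0..\<tau> m} \<phi> + integral {\<tau> m..\<tau> (Suc m)} \<phi> = integral {\<tau> 0..\<tau> (Suc m)} \<phi>"
        using Suc.prems by (intro Henstock_Kurzweil_Integration.integral_combine \<tau>le io) auto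
      thus ?case using Suc by simp
    qed simp
    have "real (card C) * (2 * pi / real n) = (\<Sum>j\<in>C. 2 * pi / real n)" by simp
    also have "\<dots> \<le> (\<Sum>j\<in>C. integral {\<tau> j..\<tau> (Suc j)} \<phi>)"
    proof (rule sum_mono)
      fix j assume j: "j \<in> C"
      have "2 * pi / real n = integral {\<tau> j..\<tau> (Suc j)} (\<lambda>_. 1)"
        using \<tau>lt[of j] \<tau>Suc[of j] by simp
      also have "\<dots> \<le> integral {\<tau> j..\<tau> (Suc j)} \<phi>"
      proof (rule integral_le)
        show "1 \<le> \<phi> t" if "t \<in> {\<tau> j..\<tau> (Suc j)}" for t
          using j that c(2) by (intro phi1) (force simp: C_def)
      qed (use j in \<open>auto simp: C_def integrable_const_ivl intro: io\<close>)
      finally show "2 * pi / real n \<le> integral {\<tau> j..\<tau> (Suc j)} \<phi>" .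
    qed
    also have "\<dots> \<le> (\<Sum>j<n. integral {\<tau> j..\<tau> (Suc j)} \<phi>)"
      using phi0 by (intro sum_mono2 integral_nonneg io) (auto simp: C_def)
    also have "\<dots> = integral {0..2*pi} \<phi>" using split[of n] by (simp add: \<tau>0 \<tau>n)
    finally show ?thesis .
  qed
  hence "real (card C) * (2 * pi / real n) \<le> 2 * pi * \<kappa>" using int by linarith
  hence "real (card C) \<le> \<kappa> * real n" using n by (simp add: field_simps)
  moreover have "real n \<le> real (card Xp) + real (card Xm) + 2 * real (card C)"
    using main by (metis of_nat_add of_nat_le_iff of_nat_mult of_nat_numeral)
  moreover have "real (card Xp) \<le> 2 * real (card (Z g \<eta>))" "real (card Xm) \<le> 2 * real (card (Z g (- \<eta>)))"
    using Xp Xm by linarith+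
  ultimately show ?thesis by (simp add: algebra_simps)
qed

section \<open>Solutions of the level equation\<close>

text \<open>The shift by half a period, taken modulo \<open>2 * pi\<close>, exchanges the two level
  sets.\<close>

lemma card_rs_a_level_neg:
  assumes "k \<ge> 1"
  shows "card {t. 0 \<le> t \<and> t < 2 * pi \<and> rs_a k t = c} = card {t. 0 \<le> t \<and> t < 2 * pi \<and> rs_a k t = - c}"
proof -
  have "card {t. 0 \<le> t \<and> t < 2 * pi \<and> rs_a k t = c} \<le> card {t. 0 \<le> t \<and> t < 2 * pi \<and> rs_a k t = - c}" for c
  proof (rule card_inj_on_le[where f = "\<lambda>t. if t < pi then t + pi else t - pi"])
    show "inj_on (\<lambda>t. if t < pi then t + pi else t - pi) {t. 0 \<le> t \<and> t < 2 * pi \<and> rs_a k t = c}"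
      by (auto simp: inj_on_def split: if_splits)
    show "(\<lambda>t. if t < pi then t + pi else t - pi) ` {t. 0 \<le> t \<and> t < 2 * pi \<and> rs_a k t = c}
        \<subseteq> {t. 0 \<le> t \<and> t < 2 * pi \<and> rs_a k t = - c}"
    proof -
      have "rs_a k (t - pi) = - rs_a k t" for t
        using rs_a_add_pi[OF assms, of "t - pi"] by simp
      thus ?thesis using rs_a_add_pi[OF assms] by auto
    qed
  qed (rule rs_a_level_card[OF assms])
  from this[of c] this[of "- c"] show ?thesis by simp
qed

lemma rs_a_level_count:
  fixes \<eta> \<epsilon> :: real
  assumes "0 \<le> \<eta>" "\<epsilon> > 0"
  shows "\<exists>k0\<ge>1. \<forall>k\<ge>k0. (1/2 - \<eta> - \<epsilon>) * 2 ^ k / 2 \<le> real (card {t. 0 \<le> t \<and> t < 2 * pi \<and> rs_a k t = \<eta>})"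
proof -
  \<comment> \<open>The majorant belongs to the band of half-width \<open>\<eta> + \<delta>\<close>
    and has error \<open>\<delta>\<close>, so its integral is at most
    \<open>\<eta> + \<epsilon> / 2\<close>. The slack makes the bound hold for all large
    indices.\<close>
  define \<delta> where "\<delta> = \<epsilon> / 4"
  have \<delta>: "\<delta> > 0" using assms by (simp add: \<delta>_def)
  obtain p :: "real poly" where p0: "\<And>x. x \<in> {0..1} \<Longrightarrow> 0 \<le> poly p x"
    and p1: "\<And>x. x \<in> {0..1} \<Longrightarrow> \<bar>2 * x - 1\<bar> \<le> \<eta> + \<delta> \<Longrightarrow> 1 \<le> poly p x"
    and pint: "integral {0..1} (poly p) \<le> (\<eta> + \<delta>) + \<delta>"
    using polynomial_majorant[of "\<eta> + \<delta>" \<delta>] assms(1) \<delta> by (metis add_nonneg_pos less_imp_le)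
  have "2 * pi * integral {0..1} (poly p) < 2 * pi * (\<eta> + \<epsilon>)"
    using pint assms by (intro mult_strict_left_mono) (auto simp: \<delta>_def)
  from order_tendstoD(2)[OF rs_a_equidistributed this]
  obtain m0 where m0: "\<And>m. m \<ge> m0 \<Longrightarrow>
      integral {0..2*pi} (\<lambda>t. poly p ((1 + rs_a m t) / 2)) < 2 * pi * (\<eta> + \<epsilon>)"
    unfolding eventually_sequentially by blast
  \<comment> \<open>Adding 3 rather than 2 ensures \<open>m = k - 2 \<ge> 1\<close>, as the level
    counts demand.\<close>
  have "(1/2 - \<eta> - \<epsilon>) * 2 ^ k / 2 \<le> real (card {t. 0 \<le> t \<and> t < 2 * pi \<and> rs_a k t = \<eta>})" if "k \<ge> m0 + 3" for k
  proof -
    define m where "m = k - 2"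
    have k: "k = Suc (Suc m)" and m: "m \<ge> 1" "m \<ge> m0" using that by (auto simp: m_def)
    have x: "(1 + rs_a m t) / 2 \<in> {0..1}" for t
      using abs_rs_a_le[of m t] by (auto simp: abs_le_iff)
    have "real (2 ^ k) - 2 * (\<eta> + \<epsilon>) * real (2 ^ k) \<le>
        2 * real (card {t. 0 \<le> t \<and> t < 2 * pi \<and> rs_a k t = \<eta>}) +
        2 * real (card {t. 0 \<le> t \<and> t < 2 * pi \<and> rs_a k t = - \<eta>})"
    proof (rule alternating_sample_count[where f = "rs_a m" and g = "rs_a k" and \<delta> = \<delta>
          and \<phi> = "\<lambda>t. poly p ((1 + rs_a m t) / 2)"])
      show "rs_a k (2 * pi * real j / real (2 ^ k)) = (-1) ^ j * rs_a m (2 * pi * real j / real (2 ^ k))" for j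
        using rs_a_sample[of m j] by (simp add: k)
      show "2 * card {t. 0 \<le> t \<and> t < 2 * pi \<and> rs_a m t = v} \<le> 2 ^ k" for v
        using rs_a_level_card(2)[OF m(1), of v] by (simp add: k)
      show "1 \<le> poly p ((1 + rs_a m t) / 2)" if "\<bar>rs_a m t\<bar> \<le> \<eta> + \<delta>" for t
      proof (rule p1[OF x])
        have "2 * ((1 + rs_a m t) / 2) - 1 = rs_a m t" by (simp add: field_simps)
        thus "\<bar>2 * ((1 + rs_a m t) / 2) - 1\<bar> \<le> \<eta> + \<delta>" using that by (simp only:)
      qed
      show "integral {0..2*pi} (\<lambda>t. poly p ((1 + rs_a m t) / 2)) \<le> 2 * pi * (\<eta> + \<epsilon>)"
        using m0[OF m(2)] by simp
      show "continuous_on {0..2*pi} (\<lambda>t. poly p ((1 + rs_a m t) / 2))"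
        by (intro continuous_intros continuous_rs_a) simp
      show "finite {t. 0 \<le> t \<and> t < 2 * pi \<and> rs_a m t = v}" for v
        by (rule rs_a_level_card[OF m(1)])
    qed (simp_all add: continuous_rs_a rs_a_2pi rs_a_level_card(1) k p0 x assms \<delta> del: atLeastAtMost_iff)
    moreover have "k \<ge> 1" by (simp add: k)
    \<comment> \<open>Both levels have the same count, so four times it is at least
      \<open>(1 - 2 * (\<eta> + \<epsilon>)) * 2 ^ k\<close>.\<close>
    ultimately show ?thesis
      using card_rs_a_level_neg[of k \<eta>] by (simp add: algebra_simps)
  qed
  thus ?thesis by (intro exI[of _ "m0 + 3"]) auto
qed

theorem theorem2p2:
  fixes F :: "nat \<Rightarrow> int poly" and \<eta> \<epsilon> :: real
  assumes "F = RS_P \<or> F = RS_Q"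
    and "-1/2 < \<eta>" and "\<eta> < 1/2" and "\<epsilon> > 0"
  shows "\<exists>k0. \<forall>k\<ge>k0. \<exists>S. finite S \<and>
           S \<subseteq> {t. 0 \<le> t \<and> t < 2 * pi \<and>
                       sqmod_on_circle (F k) t = (1 + \<eta>) * 2 ^ k} \<and>
           real (card S) \<ge> (1/2 - \<bar>\<eta>\<bar> - \<epsilon>) * 2 ^ k / 2"
proof -
  define Z where "Z k c = {t. 0 \<le> t \<and> t < 2 * pi \<and> rs_a k t = c}" for k c
  obtain k0 where k0: "k0 \<ge> 1"
    "\<And>k. k \<ge> k0 \<Longrightarrow> (1/2 - \<bar>\<eta>\<bar> - \<epsilon>) * 2 ^ k / 2 \<le> real (card (Z k \<bar>\<eta>\<bar>))"
    using rs_a_level_count[of "\<bar>\<eta>\<bar>" \<epsilon>] assms(4) unfolding Z_def by auto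
  \<comment> \<open>By \<open>cmod_rs_q\<close> the sign of \<open>rs_a k\<close> is reversed for Q,
    so the level changes sign; by \<open>card_rs_a_level_neg\<close> the count does not.\<close>
  define c where "c = (if F = RS_P then \<eta> else - \<eta>)"
  have c: "sqmod_on_circle (F k) t = (1 + \<eta>) * 2 ^ k" if "rs_a k t = c" for k t
  proof (cases "F = RS_P")
    case True
    have "sqmod_on_circle (RS_P k) t = (cmod (rs_p k t))\<^sup>2"
      by (simp add: sqmod_on_circle_def rs_p_def)
    thus ?thesis using that True by (simp add: cmod_rs_p c_def)
  next
    case False
    have "sqmod_on_circle (RS_Q k) t = (cmod (rs_q k t))\<^sup>2"
      by (simp add: sqmod_on_circle_def rs_q_def)
    thus ?thesis using that False assms(1) by (simp add: cmod_rs_q c_def)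
  qed
  show ?thesis
  proof (intro exI allI impI conjI)
    fix k assume k: "k \<ge> k0"
    hence k1: "k \<ge> 1" using k0(1) by simp
    show "finite (Z k c)" unfolding Z_def by (rule rs_a_level_card[OF k1])
    show "Z k c \<subseteq> {t. 0 \<le> t \<and> t < 2 * pi \<and> sqmod_on_circle (F k) t = (1 + \<eta>) * 2 ^ k}"
      using c by (auto simp: Z_def)
    have "c = \<bar>\<eta>\<bar> \<or> c = - \<bar>\<eta>\<bar>" by (auto simp: c_def abs_if)
    hence "card (Z k c) = card (Z k \<bar>\<eta>\<bar>)"
      using card_rs_a_level_neg[OF k1, of "\<bar>\<eta>\<bar>"] unfolding Z_def by auto
    thus "(1/2 - \<bar>\<eta>\<bar> - \<epsilon>) * 2 ^ k / 2 \<le> real (card (Z k c))"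
      using k0(2)[OF k] by simp
  qed
qed

end
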